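(* Let $d\ge 1$ and let $\{\xi(z):z\in\mathbb{Z}^d\}$ be independent identically distributed random variables with distribution function $F(x)=P(\xi(0)\le x)=1-x^{-\alpha}$ for $x\ge 1$ (and $F(x)=0$ for $x<1$), for some $\alpha>d$. Let $U(t)$ be the total mass of the solution of the parabolic Anderson problem with potential $\xi$ and localized initial condition, and let $L_t=\frac1t\log U(t)$. Then, almost surely, $$\limsup_{t\to\infty}\frac{\log L_t-\frac{d}{\alpha-d}\log t}{\log\log t}=-\frac{d-1}{\alpha-d}\qquad\text{if } d>1,$$ $$\limsup_{t\to\infty}\frac{\log L_t-\frac{d}{\alpha-d}\log t}{\log\log\log t}=\frac{1}{\alpha-d}\qquad\text{if } d=1,$$ and $$\liminf_{t\to\infty}\frac{\log L_t-\frac{d}{\alpha-d}\log t}{\log\log t}=-\frac{d}{\alpha-d}\qquad\text{for all } d\ge1.$$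
   Context: The parabolic Anderson problem is the Cauchy problem $\partial_t u(t,z)=\Delta^{\mathrm d}u(t,z)+\xi(z)u(t,z)$ for $(t,z)\in(0,\infty)\times\mathbb{Z}^d$, $u(0,z)=\mathbf 1_0(z)$, where $(\Delta^{\mathrm d}f)(z)=\sum_{y\sim z}[f(y)-f(z)]$ is the discrete Laplacian (sum over the $2d$ nearest neighbours of $z$). For the potentials considered here it almost surely has a unique nonnegative solution $u$; its total mass is $U(t)=\sum_{z\in\mathbb{Z}^d}u(t,z)$. By the Feynman–Kac formula, $U(t)=\mathbb{E}_0[\exp\{\int_0^t\xi(X_s)\,ds\}]$, where $(X_s)_{s\ge0}$ is the continuous-time simple random walk on $\mathbb{Z}^d$ with generator $\Delta^{\mathrm d}$ (total jump rate $2d$), independent of $\xi$, started at $0$, and $\mathbb{E}_0$ denotes expectation over the walk only. *)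

theory Defs
  imports "HOL-Probability.Probability"
begin

text \<open>
  The lattice \<open>\<int>\<^sup>d\<close> is the type \<open>int ^ 'd\<close> with \<open>d = CARD('d)\<close>. Functions of time and space
  have type \<open>real \<Rightarrow> int ^ 'd \<Rightarrow> real\<close>.
\<close>

definition nearest_neighbours :: "int ^ 'd::finite \<Rightarrow> (int ^ 'd) set" where
  "nearest_neighbours z = {y. (\<Sum>i\<in>UNIV. \<bar>y $ i - z $ i\<bar>) = 1}"

lemma finite_nearest_neighbours: "finite (nearest_neighbours (z :: int ^ 'd::finite))"
proof -
  have "nearest_neighbours z \<subseteq> vec_lambda ` (UNIV \<rightarrow>\<^sub>E (\<Union>i. {z $ i - 1..z $ i + 1}))"
  proof
    fix y assume "y \<in> nearest_neighbours z"
    then have s: "(\<Sum>i\<in>UNIV. \<bar>y $ i - z $ i\<bar>) = 1"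
      by (simp add: nearest_neighbours_def)
    have "\<bar>y $ i - z $ i\<bar> \<le> 1" for i
      using member_le_sum[of i UNIV "\<lambda>i. \<bar>y $ i - z $ i\<bar>"] s by simp
    then have "y $ i \<in> {z $ i - 1..z $ i + 1}" for i
      using abs_le_D1[of "y $ i - z $ i" 1] abs_le_D2[of "y $ i - z $ i" 1]
      by (simp add: algebra_simps)
    then have "vec_nth y \<in> UNIV \<rightarrow>\<^sub>E (\<Union>i. {z $ i - 1..z $ i + 1})"
      unfolding PiE_UNIV_domain by blast
    then show "y \<in> vec_lambda ` (UNIV \<rightarrow>\<^sub>E (\<Union>i. {z $ i - 1..z $ i + 1}))"
      by (rule image_eqI[rotated]) (simp add: vec_nth_inverse)
  qed
  moreover have "finite (UNIV \<rightarrow>\<^sub>E (\<Union>i. {z $ i - 1..z $ i + 1}) :: ('d \<Rightarrow> int) set)"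
    by (intro finite_PiE) auto
  ultimately show ?thesis
    by (meson finite_imageI finite_subset)
qed

definition discrete_laplacian :: "(int ^ 'd::finite \<Rightarrow> real) \<Rightarrow> int ^ 'd \<Rightarrow> real" where
  "discrete_laplacian f z = (\<Sum>y\<in>nearest_neighbours z. f y - f z)"

text \<open>
  Nonnegative solutions of the parabolic Anderson problem with potential \<open>V\<close> and localized
  initial condition. The initial value is attained continuously; the differential equation is
  required on \<open>(0, \<infinity>)\<close>. The last clause fixes the values at negative times, which have no meaning,
  so that a solution can be unique as a function on all of \<open>real\<close>.
\<close>

definition is_pam_solution ::
    "(int ^ 'd::finite \<Rightarrow> real) \<Rightarrow> (real \<Rightarrow> int ^ 'd \<Rightarrow> real) \<Rightarrow> bool" where
  "is_pam_solution V u \<longleftrightarrow>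
     (\<forall>t\<ge>0. \<forall>z. 0 \<le> u t z) \<and>
     (\<forall>z. continuous_on {0..} (\<lambda>t. u t z)) \<and>
     (\<forall>t>0. \<forall>z. ((\<lambda>s. u s z) has_real_derivative
        (discrete_laplacian (u t) z + V z * u t z)) (at t)) \<and>
     (\<forall>z. u 0 z = (if z = 0 then 1 else 0)) \<and>
     (\<forall>t<0. \<forall>z. u t z = 0)"

text \<open>Meaningful for potentials for which the nonnegative solution exists and is unique.\<close>

definition pam_solution :: "(int ^ 'd::finite \<Rightarrow> real) \<Rightarrow> real \<Rightarrow> int ^ 'd \<Rightarrow> real" where
  "pam_solution V = (THE u. is_pam_solution V u)"

definition pam_total_mass :: "(int ^ 'd::finite \<Rightarrow> real) \<Rightarrow> real \<Rightarrow> real" where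
  "pam_total_mass V t = (\<Sum>\<^sub>\<infinity>z. pam_solution V t z)"

definition pam_growth_rate :: "(int ^ 'd::finite \<Rightarrow> real) \<Rightarrow> real \<Rightarrow> real" where
  "pam_growth_rate V t = 1 / t * ln (pam_total_mass V t)"

end

theory Submission
  imports Defs "HOL-Real_Asymp.Real_Asymp"
begin

text \<open>
  The differences in the theorem are divided by iterated logarithms of \<open>t\<close>, so the growth rate \<open>L\<^sub>t\<close>
  need only be known up to constant factors. At this precision it is
  the maximum over \<open>z\<close> of \<open>\<xi> z - c |z| log t / t\<close>, and both bounds
  follow from the differential equation itself, without the Feynman-Kac formula.

  Lower bound. Mass that travels from the origin to \<open>z\<close> up to time \<open>t / 2\<close> and stays there until
  time \<open>t\<close> gives \<open>L\<^sub>t \<ge> \<xi> z / 2 - 2d - |z| log |z| / t\<close>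
  (\<open>nonneg_solution_spread\<close>, \<open>nonneg_solution_stay\<close>, \<open>pam_growth_rate_lower_bound\<close>).

  Upper bound. If \<open>\<xi> z \<le> \<lambda> + h |z|\<close> for all \<open>z\<close>, then the mass at time \<open>s\<close>, weighted by
  \<open>exp (h |z| (t - s))\<close>, grows at rate at most \<open>\<lambda> + 2d exp (h t)\<close>: the decay of the weight absorbs
  the linear part of the potential, and neighbouring weights differ by a factor of at most \<open>exp (h t)\<close>.
  Hence \<open>L\<^sub>t \<le> \<lambda> + 2d exp (h t)\<close> (\<open>picard_mass_bound\<close>, \<open>pam_growth_rate_upper_bound\<close>). For
  \<open>h = c log t / t\<close> with small \<open>c\<close> the second term is a small power of \<open>t\<close> and is negligible.

  The same weighted bound, applied to Picard iterates of Duhamel's formula, shows that the iterates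
  converge to a minimal nonnegative solution whenever the potential grows at most linearly. There is no
  other one: every nonnegative solution is at most factorially large in space, while at the
  origin, up to time \<open>\<delta>\<close>, a solution with zero initial value is bounded by its supremum over the ball of
  radius \<open>n\<close> times \<open>(2d \<delta>) ^ n / n!\<close> and a factor exponential in \<open>n \<delta>\<close> (\<open>nonneg_solution_zero\<close>).

  Extremes of the potential. Write \<open>\<beta> = d / \<alpha>\<close> and \<open>q = \<beta> / (1 - \<beta>) = d / (\<alpha> - d)\<close>. All
  comparisons use scales \<open>F x = x ^ \<beta> (log x) ^ \<kappa> (log log x) ^ \<mu>\<close>. A peak of size \<open>F x\<close> at
  distance \<open>x\<close> decides the growth rate at times \<open>t\<close> of order \<open>x log x / F x\<close>, and then \<open>L\<^sub>t\<close> is of order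
  \<open>F x\<close> (\<open>cone_growth\<close>, \<open>peak_growth\<close>). Taking logarithms,
  \<open>log (F x) - q log t = (\<kappa> - q (1 - \<kappa>)) log log x + \<mu> (1 + q) log log log x + O(1)\<close>,
  and \<open>log log x\<close> may be replaced by \<open>log log t\<close> (\<open>log_excess_eq\<close>). The Borel-Cantelli lemmas over
  dyadic scales \<open>x = 2 ^ j\<close> determine \<open>\<kappa>\<close> and \<open>\<mu>\<close>. The expected number
  of sites at distance \<open>2 ^ j\<close> that exceed \<open>F (2 ^ j)\<close> is of order
  \<open>j ^ (- \<alpha> \<kappa>) (log j) ^ (- \<alpha> \<mu>)\<close>, so the highest peaks
  seen infinitely often have \<open>\<kappa> = 1 / \<alpha>\<close> and \<open>\<mu> = 1 / \<alpha>\<close>, the latter up to an arbitrarily small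
  error. This gives the upper limits: \<open>\<kappa> - q (1 - \<kappa>)\<close> is then \<open>- (d - 1) / (\<alpha> - d)\<close>, which vanishes
  for \<open>d = 1\<close>, where the next order \<open>\<mu> (1 + q) = 1 / (\<alpha> - d)\<close> becomes visible. The typical maximum has
  \<open>\<kappa> = 0\<close> up to an arbitrarily small error. Almost surely it is not smaller from
  some scale on, and at infinitely many scales nothing larger is in reach; this gives the lower limit \<open>- q\<close>.
\<close>

section \<open>The lattice\<close>

definition norm1 :: "int ^ 'd::finite \<Rightarrow> nat" where
  "norm1 z = nat (\<Sum>i\<in>UNIV. \<bar>z $ i\<bar>)"

lemma int_norm1: "int (norm1 z) = (\<Sum>i\<in>UNIV. \<bar>z $ i\<bar>)"
  by (simp add: norm1_def sum_nonneg)

lemma norm1_zero [simp]: "norm1 0 = 0"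
  by (simp add: norm1_def)

lemma norm1_eq_0_iff [simp]: "norm1 z = 0 \<longleftrightarrow> z = 0"
proof -
  have "norm1 z = 0 \<longleftrightarrow> (\<Sum>i\<in>UNIV. \<bar>z $ i\<bar>) = 0"
    using int_norm1[of z] by linarith
  also have "\<dots> \<longleftrightarrow> z = 0"
    by (subst sum_nonneg_eq_0_iff) (auto simp: vec_eq_iff)
  finally show ?thesis .
qed

lemma norm1_triangle: "norm1 (x + y) \<le> norm1 x + norm1 y"
proof -
  have "int (norm1 (x + y)) \<le> int (norm1 x + norm1 y)"
    by (simp add: int_norm1 flip: sum.distrib) (intro sum_mono abs_triangle_ineq)
  then show ?thesis by linarith
qed

lemma norm1_minus_commute: "norm1 (x - y) = norm1 (y - x)"
  by (simp add: norm1_def abs_minus_commute)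

lemma abs_component_le_norm1: "\<bar>z $ i\<bar> \<le> int (norm1 z)"
  unfolding int_norm1 by (rule member_le_sum) auto

lemma nearest_neighbours_iff: "y \<in> nearest_neighbours z \<longleftrightarrow> norm1 (y - z) = 1"
proof -
  have "norm1 (y - z) = 1 \<longleftrightarrow> (\<Sum>i\<in>UNIV. \<bar>(y - z) $ i\<bar>) = 1"
    unfolding int_norm1[symmetric] by simp
  then show ?thesis by (simp add: nearest_neighbours_def)
qed

lemma nearest_neighbours_sym: "y \<in> nearest_neighbours z \<longleftrightarrow> z \<in> nearest_neighbours y"
  by (simp add: nearest_neighbours_iff norm1_minus_commute)

lemma nearest_neighbours_norm1:
  assumes "y \<in> nearest_neighbours z"
  shows "norm1 y \<le> norm1 z + 1" "norm1 z \<le> norm1 y + 1"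
  using assms norm1_triangle[of z "y - z"] norm1_triangle[of y "z - y"]
  by (simp_all add: nearest_neighbours_iff norm1_minus_commute)

text \<open>
  The number \<open>2d\<close>: the total jump rate of the walk, and the coefficient of the diagonal part of the
  Laplacian.
\<close>

definition lattice_degree :: "'d::finite itself \<Rightarrow> real" where
  "lattice_degree _ = real (card (nearest_neighbours (0 :: int ^ 'd)))"

lemma lattice_degree_nonneg [simp]: "0 \<le> lattice_degree TYPE('d::finite)"
  by (simp add: lattice_degree_def)

lemma card_nearest_neighbours:
  "real (card (nearest_neighbours (z :: int ^ 'd::finite))) = lattice_degree TYPE('d)"
proof -
  have "bij_betw (\<lambda>y. y + z) (nearest_neighbours 0) (nearest_neighbours z)"
    by (rule bij_betwI[where g = "\<lambda>y. y - z"]) (auto simp: nearest_neighbours_iff)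
  then show ?thesis
    by (simp add: lattice_degree_def bij_betw_same_card)
qed

lemma discrete_laplacian_eq:
  "discrete_laplacian f (z :: int ^ 'd::finite)
     = (\<Sum>y\<in>nearest_neighbours z. f y) - lattice_degree TYPE('d) * f z"
  by (simp add: discrete_laplacian_def sum_subtractf card_nearest_neighbours)

lemma nearest_neighbour_towards_origin:
  assumes "norm1 (z :: int ^ 'd::finite) = Suc n"
  obtains y where "y \<in> nearest_neighbours z" "norm1 y = n"
proof -
  have "z \<noteq> 0" using assms by force
  then obtain i where i: "z $ i \<noteq> 0" by (auto simp: vec_eq_iff)
  define y where "y = (\<chi> j. if j = i then z $ j - sgn (z $ j) else z $ j)"
  have 1: "\<bar>(y - z) $ j\<bar> = (if j = i then 1 else 0)" for j
    using i by (auto simp: y_def abs_sgn_eq)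
  have "int (norm1 (y - z)) = 1"
    unfolding int_norm1 1 by simp
  moreover have "int (norm1 y) = int (norm1 z) - 1"
  proof -
    have "\<bar>y $ j\<bar> = \<bar>z $ j\<bar> - (if j = i then 1 else 0)" for j
      using i by (auto simp: y_def abs_if sgn_if)
    then show ?thesis
      unfolding int_norm1 by (simp add: sum_subtractf)
  qed
  ultimately show thesis
    using that[of y] assms by (simp add: nearest_neighbours_iff)
qed

text \<open>
  The boxes and corners on which the potential is examined are product sets, so this one count serves
  all union bounds and products of probabilities.
\<close>

lemma card_vec_set:
  "card {z :: int ^ 'd::finite. \<forall>i. z $ i \<in> A} = card A ^ CARD('d)"
proof -
  have "bij_betw vec_lambda (UNIV \<rightarrow>\<^sub>E A) {z :: int ^ 'd. \<forall>i. z $ i \<in> A}"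
    by (rule bij_betwI[where g = vec_nth]) auto
  then show ?thesis
    by (simp add: bij_betw_same_card[symmetric] card_PiE)
qed

lemma finite_vec_set:
  assumes "finite A"
  shows "finite {z :: int ^ 'd::finite. \<forall>i. z $ i \<in> A}"
proof -
  have "bij_betw vec_lambda (UNIV \<rightarrow>\<^sub>E A) {z :: int ^ 'd. \<forall>i. z $ i \<in> A}"
    by (rule bij_betwI[where g = vec_nth]) auto
  moreover have "finite (UNIV \<rightarrow>\<^sub>E A :: ('d \<Rightarrow> int) set)"
    using assms by (intro finite_PiE) auto
  ultimately show ?thesis
    by (metis bij_betw_finite)
qed

lemma finite_norm1_ball: "finite {z :: int ^ 'd::finite. norm1 z \<le> n}"
proof (rule finite_subset)
  show "{z :: int ^ 'd. norm1 z \<le> n} \<subseteq> {z. \<forall>i. z $ i \<in> {- int n..int n}}"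
  proof clarify
    fix z :: "int ^ 'd" and i
    assume "norm1 z \<le> n"
    then show "z $ i \<in> {- int n..int n}"
      using abs_component_le_norm1[of z i] by auto
  qed
qed (rule finite_vec_set, simp)

section \<open>Lower bounds for nonnegative solutions\<close>

text \<open>
  The initial value is left free, so that the notion is stable under shifting time forward and applies
  to the difference of an arbitrary solution and the minimal one.
\<close>

definition nonneg_solution ::
    "(int ^ 'd::finite \<Rightarrow> real) \<Rightarrow> (real \<Rightarrow> int ^ 'd \<Rightarrow> real) \<Rightarrow> bool" where
  "nonneg_solution V w \<longleftrightarrow>
     (\<forall>t\<ge>0. \<forall>z. 0 \<le> w t z) \<and>
     (\<forall>z. continuous_on {0..} (\<lambda>t. w t z)) \<and>
     (\<forall>t>0. \<forall>z. ((\<lambda>s. w s z) has_real_derivative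
        (discrete_laplacian (w t) z + V z * w t z)) (at t))"

lemma is_pam_solution_iff:
  "is_pam_solution V u \<longleftrightarrow> nonneg_solution V u \<and>
     (\<forall>z. u 0 z = (if z = 0 then 1 else 0)) \<and> (\<forall>t<0. \<forall>z. u t z = 0)"
  unfolding is_pam_solution_def nonneg_solution_def by blast

lemma nonneg_solution_nonneg: "nonneg_solution V w \<Longrightarrow> 0 \<le> t \<Longrightarrow> 0 \<le> w t z"
  by (simp add: nonneg_solution_def)

lemma nonneg_solution_continuous:
  assumes "nonneg_solution V w" "S \<subseteq> {0..}"
  shows "continuous_on S (\<lambda>t. w t z)"
  using assms continuous_on_subset unfolding nonneg_solution_def by blast

lemma nonneg_solution_derivative:
  fixes V :: "int ^ 'd::finite \<Rightarrow> real"
  assumes "nonneg_solution V w" "t > 0"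
  shows "((\<lambda>s. w s z) has_real_derivative
     ((\<Sum>y\<in>nearest_neighbours z. w t y) + (V z - lattice_degree TYPE('d)) * w t z)) (at t)"
  using assms by (simp add: nonneg_solution_def discrete_laplacian_eq algebra_simps)

lemma nonneg_solution_shift:
  assumes w: "nonneg_solution V w" and r: "r \<ge> 0"
  shows "nonneg_solution V (\<lambda>t. w (r + t))"
  unfolding nonneg_solution_def
proof (intro conjI allI impI)
  fix t :: real and z
  show "0 \<le> w (r + t) z" if "0 \<le> t"
    using nonneg_solution_nonneg[OF w] r that by simp
  show "continuous_on {0..} (\<lambda>t. w (r + t) z)"
    using r by (intro continuous_on_compose2[OF nonneg_solution_continuous[OF w order_refl]])
               (auto intro!: continuous_intros)
  show "((\<lambda>s. w (r + s) z) has_real_derivative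
      discrete_laplacian (w (r + t)) z + V z * w (r + t) z) (at t)" if "0 < t"
    using w r that DERIV_shift[of "\<lambda>s. w s z" "discrete_laplacian (w (r + t)) z + V z * w (r + t) z" t r]
    unfolding nonneg_solution_def by (simp add: add.commute)
qed

lemma has_derivative_exp_mult:
  assumes "(f has_real_derivative D) (at t)"
  shows "((\<lambda>s. exp (c * s) * f s) has_real_derivative exp (c * t) * (D + c * f t)) (at t)"
  by (rule derivative_eq_intros assms refl)+ (simp add: algebra_simps)

text \<open>
  Gronwall's inequality, in the form in which it is used for lower bounds on solutions and, with
  \<open>- f\<close> in place of \<open>f\<close>, for upper bounds on weighted masses.
\<close>

lemma exp_mult_nondecreasing:
  fixes f :: "real \<Rightarrow> real"
  assumes "a \<le> b" "continuous_on {a..b} f"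
    and "\<And>t. a < t \<Longrightarrow> t < b \<Longrightarrow> \<exists>D. (f has_real_derivative D) (at t) \<and> c * f t \<le> D"
  shows "exp (c * (b - a)) * f a \<le> f b"
proof -
  have "exp (- c * a) * f a \<le> exp (- c * b) * f b"
  proof (rule DERIV_nonneg_imp_increasing_open[OF \<open>a \<le> b\<close>])
    fix t assume "a < t" "t < b"
    then obtain D where D: "(f has_real_derivative D) (at t)" "c * f t \<le> D"
      using assms(3) by blast
    show "\<exists>y. ((\<lambda>t. exp (- c * t) * f t) has_real_derivative y) (at t) \<and> 0 \<le> y"
      using has_derivative_exp_mult[OF D(1), of "- c"] D(2) by (intro exI conjI) auto
  qed (intro continuous_intros assms)
  then have "exp (c * b) * (exp (- c * a) * f a) \<le> exp (c * b) * (exp (- c * b) * f b)"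
    by (intro mult_left_mono) auto
  then show ?thesis
    by (simp add: right_diff_distrib exp_diff exp_minus field_simps)
qed

text \<open>
  Mass that stays at its site: the inflow from the neighbours is nonnegative and is dropped.
\<close>

lemma nonneg_solution_stay:
  fixes V :: "int ^ 'd::finite \<Rightarrow> real"
  assumes w: "nonneg_solution V w" and "0 \<le> s" "s \<le> t"
  shows "exp ((V z - lattice_degree TYPE('d)) * (t - s)) * w s z \<le> w t z"
proof (rule exp_mult_nondecreasing[OF \<open>s \<le> t\<close>])
  show "continuous_on {s..t} (\<lambda>t. w t z)"
    using assms by (intro nonneg_solution_continuous[OF w]) auto
  fix r assume "s < r" "r < t"
  then have "r > 0" using assms by simp
  then show "\<exists>D. ((\<lambda>t. w t z) has_real_derivative D) (at r) \<and>
      (V z - lattice_degree TYPE('d)) * w r z \<le> D"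
    using nonneg_solution_derivative[OF w, of r z] nonneg_solution_nonneg[OF w]
    by (intro exI conjI) (auto intro!: sum_nonneg)
qed

text \<open>
  Mass that travels: the induction keeps only the inflow from one neighbour, a step closer to the
  starting point, and each step integrates the bound in time once more. The factor
  \<open>t ^ n / fact n\<close> is what the walk pays for making \<open>n\<close> prescribed jumps before time \<open>t\<close>. The
  nonnegative potential along the path is dropped.

  The bound has two uses. Read forward, it says how much mass reaches a high peak of the potential.
  Read backward, with the value at \<open>z\<close> known, it says that a nonnegative solution can grow at most
  factorially in space, which is what makes it unique.
\<close>

lemma nonneg_solution_spread:
  fixes V :: "int ^ 'd::finite \<Rightarrow> real"
  assumes w: "nonneg_solution V w" and V: "\<And>z. 0 \<le> V z" and "0 \<le> t"
  shows "exp (- lattice_degree TYPE('d) * t) * t ^ norm1 (z - x) / fact (norm1 (z - x)) * w 0 x \<le> w t z"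
  using \<open>0 \<le> t\<close>
proof (induction "norm1 (z - x)" arbitrary: z t)
  case 0
  then have "z = x" by (metis norm1_eq_0_iff right_minus_eq)
  have "exp (- lattice_degree TYPE('d) * t) * w 0 x \<le> exp ((V x - lattice_degree TYPE('d)) * (t - 0)) * w 0 x"
    using V[of x] 0 nonneg_solution_nonneg[OF w, of 0 x]
    by (intro mult_right_mono) (auto intro!: mult_right_mono simp: algebra_simps)
  also have "\<dots> \<le> w t x"
    using nonneg_solution_stay[OF w, of 0 t x] 0 by simp
  finally show ?case using \<open>z = x\<close> by simp
next
  case (Suc n)
  let ?D = "lattice_degree TYPE('d)"
  obtain y' where y': "y' \<in> nearest_neighbours (z - x)" "norm1 y' = n"
    using nearest_neighbour_towards_origin[of "z - x" n] Suc by metis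
  define y where "y = y' + x"
  have y: "y \<in> nearest_neighbours z" "norm1 (y - x) = n"
    using y' by (auto simp: y_def nearest_neighbours_iff algebra_simps)
  \<comment> \<open>the difference of the two sides, multiplied by \<open>exp (?D * s)\<close>, has a nonnegative derivative\<close>
  have *: "exp (?D * 0) * w 0 z - 0 ^ Suc n / fact (Suc n) * w 0 x
      \<le> exp (?D * t) * w t z - t ^ Suc n / fact (Suc n) * w 0 x"
  proof (rule DERIV_nonneg_imp_increasing_open[OF \<open>0 \<le> t\<close>])
    fix s assume s: "0 < s" "s < t"
    let ?w' = "(\<Sum>y\<in>nearest_neighbours z. w s y) + (V z - ?D) * w s z"
    have "((\<lambda>s. exp (?D * s) * w s z - s ^ Suc n / fact (Suc n) * w 0 x) has_real_derivative
        exp (?D * s) * (?w' + ?D * w s z) - s ^ n / fact n * w 0 x) (at s)"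
    proof (rule DERIV_diff)
      show "((\<lambda>s. s ^ Suc n / fact (Suc n) * w 0 x) has_real_derivative s ^ n / fact n * w 0 x) (at s)"
        using DERIV_cmult_right[OF DERIV_pow[of "Suc n" s], of "w 0 x / fact (Suc n)"]
        by (simp add: divide_simps del: of_nat_Suc)
    qed (rule has_derivative_exp_mult, rule nonneg_solution_derivative[OF w s(1)])
    moreover have "0 \<le> exp (?D * s) * (?w' + ?D * w s z) - s ^ n / fact n * w 0 x"
    proof -
      have "w s y \<le> (\<Sum>y\<in>nearest_neighbours z. w s y)"
        using y(1) s by (intro member_le_sum) (auto intro!: nonneg_solution_nonneg[OF w] finite_nearest_neighbours)
      moreover have "0 \<le> V z * w s z"
        using s V by (intro mult_nonneg_nonneg nonneg_solution_nonneg[OF w]) auto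
      ultimately have "w s y \<le> ?w' + ?D * w s z" by (simp add: algebra_simps)
      then have "exp (?D * s) * w s y \<le> exp (?D * s) * (?w' + ?D * w s z)"
        by (intro mult_left_mono) auto
      moreover have "exp (?D * s) * (exp (- ?D * s) * s ^ n / fact n * w 0 x) \<le> exp (?D * s) * w s y"
        using Suc.hyps(1)[of y s] y s by (intro mult_left_mono) auto
      moreover have "exp (?D * s) * (exp (- ?D * s) * s ^ n / fact n * w 0 x) = s ^ n / fact n * w 0 x"
        by (simp add: exp_minus)
      ultimately show ?thesis by linarith
    qed
    ultimately show "\<exists>y. ((\<lambda>s. exp (?D * s) * w s z - s ^ Suc n / fact (Suc n) * w 0 x) has_real_derivative y) (at s) \<and> 0 \<le> y"
      by blast
  next
    show "continuous_on {0..t} (\<lambda>s. exp (?D * s) * w s z - s ^ Suc n / fact (Suc n) * w 0 x)"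
      by (intro continuous_intros nonneg_solution_continuous[OF w]) auto
  qed
  have "0 \<le> exp (?D * 0) * w 0 z - 0 ^ Suc n / fact (Suc n) * w 0 x"
    using nonneg_solution_nonneg[OF w, of 0 z] by simp
  with * have "t ^ Suc n / fact (Suc n) * w 0 x \<le> exp (?D * t) * w t z"
    by linarith
  then have "exp (- ?D * t) * (t ^ Suc n / fact (Suc n) * w 0 x) \<le> exp (- ?D * t) * (exp (?D * t) * w t z)"
    by (intro mult_left_mono) auto
  then show ?case
    unfolding \<open>Suc n = norm1 (z - x)\<close>[symmetric] by (simp add: exp_minus field_simps)
qed

section \<open>The minimal solution\<close>

lemma continuous_on_halfline:
  fixes f :: "real \<Rightarrow> real"
  assumes "\<And>b. 0 \<le> b \<Longrightarrow> continuous_on {0..b} f"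
  shows "continuous_on {0..} f"
  unfolding continuous_on_eq_continuous_within
proof
  fix t :: real assume t: "t \<in> {0..}"
  have "continuous (at t within {0..t + 1}) f"
    using assms[of "t + 1"] t by (auto simp: continuous_on_eq_continuous_within)
  moreover have "at t within {0..t + 1} = at t within {0..}"
    by (rule at_within_nhd[of t "{..<t + 1}"]) auto
  ultimately show "continuous (at t within {0..}) f" by simp
qed

lemma integral_derivative_halfline:
  fixes f :: "real \<Rightarrow> real"
  assumes "continuous_on {0..} f" "0 < t"
  shows "((\<lambda>x. integral {0..x} f) has_real_derivative f t) (at t)"
proof -
  have "((\<lambda>x. integral {0..x} f) has_real_derivative f t) (at t within {0..t + 1})"
    using assms by (intro integral_has_real_derivative continuous_on_subset[OF assms(1)]) auto
  moreover have "at t within {0..t + 1} = at t"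
    using assms(2) by (intro at_within_interior) auto
  ultimately show ?thesis by simp
qed

text \<open>
  The iterates of Duhamel's formula in which the site itself is solved exactly and only the inflow from
  the neighbours is iterated. All terms are nonnegative, so the iterates increase; the \<open>n\<close>-th one
  vanishes at distance \<open>n\<close> and beyond, so that every sum over space below is finite.
\<close>

fun picard :: "(int ^ 'd::finite \<Rightarrow> real) \<Rightarrow> nat \<Rightarrow> real \<Rightarrow> int ^ 'd \<Rightarrow> real" where
  "picard V 0 t z = 0"
| "picard V (Suc n) t z = exp ((V z - lattice_degree TYPE('d)) * t) *
     ((if z = 0 then 1 else 0) + integral {0..t}
       (\<lambda>s. exp (- (V z - lattice_degree TYPE('d)) * s) * (\<Sum>y\<in>nearest_neighbours z. picard V n s y)))"

declare picard.simps(2) [simp del]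

lemma picard_continuous: "continuous_on {0..} (\<lambda>t. picard V n t z)"
proof (induction n arbitrary: z)
  case (Suc n)
  show ?case
    unfolding picard.simps
    by (intro continuous_intros continuous_on_halfline indefinite_integral_continuous_1
          integrable_continuous_interval continuous_on_subset[OF Suc.IH]) auto
qed simp

lemma picard_integrand_continuous:
  "continuous_on {0..} (\<lambda>s. exp (a * s) * (\<Sum>y\<in>S. picard V n s y))"
  by (intro continuous_intros picard_continuous)

lemma picard_integrand_integrable:
  "(\<lambda>s. exp (a * s) * (\<Sum>y\<in>S. picard V n s y)) integrable_on {0..t}"
  by (intro integrable_continuous_interval continuous_on_subset[OF picard_integrand_continuous]) auto

lemma picard_nonneg: "0 \<le> t \<Longrightarrow> 0 \<le> picard V n t z"
proof (induction n arbitrary: z t)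
  case (Suc n)
  have "0 \<le> integral {0..t} (\<lambda>s. exp (- (V z - lattice_degree TYPE('a)) * s) * (\<Sum>y\<in>nearest_neighbours z. picard V n s y))"
    by (rule integral_nonneg[OF picard_integrand_integrable])
      (intro mult_nonneg_nonneg sum_nonneg Suc.IH, auto)
  then show ?case by (simp add: picard.simps)
qed simp

lemma picard_mono: "0 \<le> t \<Longrightarrow> picard V n t z \<le> picard V (Suc n) t z"
proof (induction n arbitrary: z t)
  case 0
  then show ?case using picard_nonneg[of t V "Suc 0" z] by simp
next
  case (Suc n)
  have "integral {0..t} (\<lambda>s. exp (- (V z - lattice_degree TYPE('a)) * s) * (\<Sum>y\<in>nearest_neighbours z. picard V n s y))
    \<le> integral {0..t} (\<lambda>s. exp (- (V z - lattice_degree TYPE('a)) * s) * (\<Sum>y\<in>nearest_neighbours z. picard V (Suc n) s y))"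
    by (rule integral_le[OF picard_integrand_integrable picard_integrand_integrable])
      (intro mult_left_mono sum_mono Suc.IH, auto)
  then show ?case
    unfolding picard.simps(2)[of V "Suc n"] picard.simps(2)[of V n]
    by (intro mult_left_mono add_left_mono) auto
qed

lemma picard_support:
  assumes "n \<le> norm1 z"
  shows "picard V n t z = 0"
  using assms
proof (induction n arbitrary: z t)
  case (Suc n)
  have "picard V n s y = 0" if "y \<in> nearest_neighbours z" for s y
    using nearest_neighbours_norm1[OF that] Suc by auto
  moreover have "z \<noteq> 0" using Suc.prems by force
  ultimately show ?case by (simp add: picard.simps)
qed simp

lemma picard_derivative:
  fixes V :: "int ^ 'd::finite \<Rightarrow> real"
  assumes "0 < t"
  shows "((\<lambda>s. picard V (Suc n) s z) has_real_derivative
     ((\<Sum>y\<in>nearest_neighbours z. picard V n t y) + (V z - lattice_degree TYPE('d)) * picard V (Suc n) t z)) (at t)"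
proof -
  define a where "a = V z - lattice_degree TYPE('d)"
  define f where "f = (\<lambda>s. exp (- a * s) * (\<Sum>y\<in>nearest_neighbours z. picard V n s y))"
  have "((\<lambda>s. (if z = 0 then 1 else 0) + integral {0..s} f) has_real_derivative 0 + f t) (at t)"
    unfolding f_def
    by (intro DERIV_add DERIV_const integral_derivative_halfline picard_integrand_continuous assms)
  from has_derivative_exp_mult[OF this, of a]
  have "((\<lambda>s. exp (a * s) * ((if z = 0 then 1 else 0) + integral {0..s} f)) has_real_derivative
     exp (a * t) * (f t + a * ((if z = 0 then 1 else 0) + integral {0..t} f))) (at t)" by simp
  moreover have "exp (a * t) * (f t + a * ((if z = 0 then 1 else 0) + integral {0..t} f))
     = (\<Sum>y\<in>nearest_neighbours z. picard V n t y) + a * picard V (Suc n) t z"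
    unfolding picard.simps a_def[symmetric] f_def by (simp add: algebra_simps exp_minus)
  ultimately show ?thesis
    unfolding picard.simps a_def[symmetric] f_def by simp
qed

text \<open>
  This makes the limit of the iterates the smallest nonnegative solution.
\<close>

lemma picard_le_solution:
  fixes V :: "int ^ 'd::finite \<Rightarrow> real"
  assumes v: "nonneg_solution V v" and v0: "v 0 0 \<ge> 1" and "0 \<le> t"
  shows "picard V n t z \<le> v t z"
  using \<open>0 \<le> t\<close>
proof (induction n arbitrary: z t)
  case 0
  then show ?case using nonneg_solution_nonneg[OF v] by simp
next
  case (Suc n)
  have "exp ((V z - lattice_degree TYPE('d)) * (t - 0)) * (v 0 z - picard V (Suc n) 0 z) \<le> v t z - picard V (Suc n) t z"
  proof (rule exp_mult_nondecreasing[OF \<open>0 \<le> t\<close>])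
    show "continuous_on {0..t} (\<lambda>t. v t z - picard V (Suc n) t z)"
      by (intro continuous_intros nonneg_solution_continuous[OF v]
          continuous_on_subset[OF picard_continuous[of V "Suc n" z]]) auto
    fix s assume s: "0 < s" "s < t"
    have "(\<Sum>y\<in>nearest_neighbours z. picard V n s y) \<le> (\<Sum>y\<in>nearest_neighbours z. v s y)"
      using s by (intro sum_mono Suc.IH) auto
    then show "\<exists>D. ((\<lambda>t. v t z - picard V (Suc n) t z) has_real_derivative D) (at s) \<and>
         (V z - lattice_degree TYPE('d)) * (v s z - picard V (Suc n) s z) \<le> D"
      using DERIV_diff[OF nonneg_solution_derivative[OF v s(1), of z] picard_derivative[OF s(1), of V n z]]
      by (intro exI conjI) (assumption, simp add: algebra_simps)
  qed
  moreover have "0 \<le> exp ((V z - lattice_degree TYPE('d)) * (t - 0)) * (v 0 z - picard V (Suc n) 0 z)"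
    using v0 nonneg_solution_nonneg[OF v, of 0 z] by (simp add: picard.simps)
  ultimately show ?case by linarith
qed

text \<open>
  Symmetry of the neighbour relation moves the Laplacian from the solution to the weight, whose values
  at neighbouring sites are comparable.
\<close>

lemma neighbour_sum_swap:
  fixes p w :: "int ^ 'd::finite \<Rightarrow> real"
  assumes "finite B" "\<And>y. y \<notin> B \<Longrightarrow> p y = 0" "\<And>y. 0 \<le> p y" "\<And>y. 0 \<le> w y" "0 \<le> k"
    and w: "\<And>y z. y \<in> nearest_neighbours z \<Longrightarrow> w z \<le> k * w y"
  shows "(\<Sum>z\<in>B. (\<Sum>y\<in>nearest_neighbours z. p y) * w z) \<le> lattice_degree TYPE('d) * k * (\<Sum>y\<in>B. p y * w y)"
proof -
  have "(\<Sum>z\<in>B. (\<Sum>y\<in>nearest_neighbours z. p y) * w z)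
      = (\<Sum>z\<in>B. \<Sum>y | y \<in> B \<and> y \<in> nearest_neighbours z. p y * w z)"
    unfolding sum_distrib_right
  proof (rule sum.cong[OF refl], rule sum.mono_neutral_right, goal_cases)
    case (3 z)
    show ?case using assms(2) by auto
  qed (auto simp: finite_nearest_neighbours)
  also have "\<dots> = (\<Sum>y\<in>B. \<Sum>z | z \<in> B \<and> y \<in> nearest_neighbours z. p y * w z)"
    by (rule sum.swap_restrict) fact+
  also have "\<dots> \<le> (\<Sum>y\<in>B. \<Sum>z\<in>nearest_neighbours y. p y * (k * w y))"
  proof (rule sum_mono)
    fix y
    have "(\<Sum>z | z \<in> B \<and> y \<in> nearest_neighbours z. p y * w z)
       \<le> (\<Sum>z\<in>{z \<in> B. y \<in> nearest_neighbours z}. p y * (k * w y))"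
      by (intro sum_mono mult_left_mono w assms) auto
    also have "\<dots> \<le> (\<Sum>z\<in>nearest_neighbours y. p y * (k * w y))"
      by (intro sum_mono2 finite_nearest_neighbours mult_nonneg_nonneg assms)
         (auto simp: nearest_neighbours_sym[of y])
    finally show "(\<Sum>z | z \<in> B \<and> y \<in> nearest_neighbours z. p y * w z) \<le> \<dots>" .
  qed
  also have "\<dots> = lattice_degree TYPE('d) * k * (\<Sum>y\<in>B. p y * w y)"
    by (simp add: card_nearest_neighbours sum_distrib_left algebra_simps)
  finally show ?thesis .
qed

text \<open>
  The upper bound on the total mass. The weight \<open>exp (h * norm1 z * (T - s))\<close> is \<open>1\<close> at
  time \<open>T\<close> and \<open>1\<close> at the origin. Its time derivative subtracts \<open>h * norm1 z\<close> from the
  potential, which leaves at most \<open>lam\<close>; its values at neighbouring sites differ by a factor of at most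
  \<open>exp (h * T)\<close>, which bounds the contribution of the Laplacian. Hence the weighted mass grows at
  rate at most \<open>lam + 2d * exp (h * T)\<close>, and it starts from \<open>1\<close>.
\<close>

lemma picard_mass_bound:
  fixes V :: "int ^ 'd::finite \<Rightarrow> real"
    and lam h T :: real
  assumes V: "\<And>z. V z \<le> lam + h * norm1 z" and h: "0 \<le> h" and T: "0 \<le> T" and F: "finite F"
  shows "(\<Sum>z\<in>F. picard V n T z) \<le> exp (T * (lam + lattice_degree TYPE('d) * exp (h * T)))"
proof (cases n)
  case (Suc m)
  define B where "B = {z :: int ^ 'd. norm1 z \<le> n}"
  have B: "finite B" unfolding B_def by (rule finite_norm1_ball)
  define p where "p = (\<lambda>s z. picard V n s z)"
  define w where "w = (\<lambda>s (z :: int ^ 'd). exp (h * norm1 z * (T - s)))"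
  define S where "S = (\<lambda>s. \<Sum>z\<in>B. p s z * w s z)"
  define D where "D = lattice_degree TYPE('d)"
  define \<kappa> where "\<kappa> = lam + D * exp (h * T)"
  have p0: "p s z = 0" if "z \<notin> B" for s z
    using that unfolding B_def p_def by (intro picard_support) auto
  have "exp (\<kappa> * (T - 0)) * (- S 0) \<le> - S T"
  proof (rule exp_mult_nondecreasing[OF T])
    show "continuous_on {0..T} (\<lambda>s. - S s)"
      unfolding S_def w_def p_def
      by (intro continuous_intros continuous_on_subset[OF picard_continuous[of V n]]) auto
    fix s assume s: "0 < s" "s < T"
    define p' where "p' = (\<lambda>z. (\<Sum>y\<in>nearest_neighbours z. picard V m s y) + (V z - D) * p s z)"
    have dp: "((\<lambda>s. p s z) has_real_derivative p' z) (at s)" for z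
      using picard_derivative[OF s(1), of V m z] by (simp add: p_def p'_def Suc D_def del: picard.simps)
    have dw: "((\<lambda>s. w s z) has_real_derivative - h * norm1 z * w s z) (at s)" for z
      unfolding w_def by (rule derivative_eq_intros refl)+ simp
    have dS: "((\<lambda>s. - S s) has_real_derivative - (\<Sum>z\<in>B. p' z * w s z + (- h * norm1 z * w s z) * p s z)) (at s)"
      unfolding S_def by (intro DERIV_minus DERIV_sum DERIV_mult dp dw)
    have w0: "0 \<le> w s z" for z by (simp add: w_def)
    have wn: "w s z \<le> exp (h * T) * w s y" if "y \<in> nearest_neighbours z" for y z
    proof -
      have "h * norm1 z * (T - s) \<le> h * (norm1 y + 1) * (T - s)"
        using nearest_neighbours_norm1[OF that] h s
        by (intro mult_right_mono mult_left_mono) auto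
      also have "\<dots> \<le> h * T + h * norm1 y * (T - s)"
        using h s by (simp add: algebra_simps)
      finally show ?thesis by (simp add: w_def flip: exp_add)
    qed
    have "(\<Sum>z\<in>B. p' z * w s z + (- h * norm1 z * w s z) * p s z)
       = (\<Sum>z\<in>B. (\<Sum>y\<in>nearest_neighbours z. picard V m s y) * w s z)
         + (\<Sum>z\<in>B. (V z - h * norm1 z - D) * (p s z * w s z))"
      unfolding p'_def sum.distrib[symmetric] by (intro sum.cong refl) (simp add: algebra_simps)
    also have "(\<Sum>z\<in>B. (\<Sum>y\<in>nearest_neighbours z. picard V m s y) * w s z)
       \<le> (\<Sum>z\<in>B. (\<Sum>y\<in>nearest_neighbours z. p s y) * w s z)"
      unfolding p_def Suc using s by (intro sum_mono mult_right_mono picard_mono w0) auto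
    also have "\<dots> \<le> D * exp (h * T) * S s"
      unfolding S_def D_def
      using s by (intro neighbour_sum_swap B p0 w0 wn) (auto simp: p_def picard_nonneg)
    also have "(\<Sum>z\<in>B. (V z - h * norm1 z - D) * (p s z * w s z)) \<le> (\<Sum>z\<in>B. lam * (p s z * w s z))"
    proof (intro sum_mono mult_right_mono)
      show "V z - h * norm1 z - D \<le> lam" for z
        using V[of z] lattice_degree_nonneg[where 'd='d] unfolding D_def by linarith
    qed (use s in \<open>auto simp: p_def w_def picard_nonneg\<close>)
    also have "\<dots> = lam * S s" by (simp add: S_def sum_distrib_left)
    finally have "(\<Sum>z\<in>B. p' z * w s z + (- h * norm1 z * w s z) * p s z) \<le> \<kappa> * S s"
      by (simp add: \<kappa>_def algebra_simps)
    with dS show "\<exists>D. ((\<lambda>s. - S s) has_real_derivative D) (at s) \<and> \<kappa> * - S s \<le> D"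
      by (intro exI conjI) auto
  qed
  moreover have "S 0 = 1"
  proof -
    have "S 0 = (\<Sum>z\<in>{0}. p 0 z * w 0 z)"
      unfolding S_def by (rule sum.mono_neutral_right) (auto simp: B, auto simp: B_def p_def Suc picard.simps)
    then show ?thesis by (simp add: p_def w_def Suc picard.simps)
  qed
  ultimately have "S T \<le> exp (T * \<kappa>)" by (simp add: mult.commute)
  moreover have "(\<Sum>z\<in>F. picard V n T z) \<le> S T"
  proof -
    have "(\<Sum>z\<in>F. picard V n T z) = (\<Sum>z\<in>F \<inter> B. p T z)"
      using F p0 unfolding p_def by (intro sum.mono_neutral_right) auto
    also have "\<dots> \<le> (\<Sum>z\<in>B. p T z)"
      using T by (intro sum_mono2 B) (auto simp: p_def picard_nonneg)
    finally show ?thesis by (simp add: S_def w_def)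
  qed
  ultimately show ?thesis by (simp add: \<kappa>_def D_def)
qed simp

text \<open>
  The value \<open>0\<close> at negative times is the one that \<^const>\<open>is_pam_solution\<close> prescribes.
\<close>

definition minimal_solution :: "(int ^ 'd::finite \<Rightarrow> real) \<Rightarrow> real \<Rightarrow> int ^ 'd \<Rightarrow> real" where
  "minimal_solution V t z = (if t < 0 then 0 else lim (\<lambda>n. picard V n t z))"

context
  fixes V :: "int ^ 'd::finite \<Rightarrow> real" and A c :: real
  assumes V_le: "\<And>z. V z \<le> A + c * norm1 z" and c: "0 \<le> c"
begin

lemma picard_tendsto:
  assumes "0 \<le> t"
  shows "(\<lambda>n. picard V n t z) \<longlonglongrightarrow> minimal_solution V t z"
proof -
  have "convergent (\<lambda>n. picard V n t z)"
  proof (rule Bseq_mono_convergent)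
    show "Bseq (\<lambda>n. picard V n t z)"
    proof (rule BseqI')
      show "norm (picard V n t z) \<le> exp (t * (A + lattice_degree TYPE('d) * exp (c * t)))" for n
        using picard_mass_bound[OF V_le c assms, of "{z}" n] picard_nonneg[OF assms, of V n z] by simp
    qed
    show "\<forall>m. \<forall>n\<ge>m. picard V m t z \<le> picard V n t z"
      using lift_Suc_mono_le[of "\<lambda>n. picard V n t z"] picard_mono[OF assms] by blast
  qed
  then show ?thesis
    using assms by (simp add: convergent_LIMSEQ_iff minimal_solution_def)
qed

lemma minimal_solution_nonneg: "0 \<le> t \<Longrightarrow> 0 \<le> minimal_solution V t z"
  by (rule LIMSEQ_le_const[OF picard_tendsto]) (auto intro: picard_nonneg)

lemma minimal_solution_sum_le:
  fixes lam h t :: real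
  assumes V: "\<And>z. V z \<le> lam + h * norm1 z" and "0 \<le> h" "0 \<le> t" "finite F"
  shows "(\<Sum>z\<in>F. minimal_solution V t z) \<le> exp (t * (lam + lattice_degree TYPE('d) * exp (h * t)))"
proof (rule LIMSEQ_le_const2)
  show "(\<lambda>n. \<Sum>z\<in>F. picard V n t z) \<longlonglongrightarrow> (\<Sum>z\<in>F. minimal_solution V t z)"
    by (intro tendsto_sum picard_tendsto assms)
qed (use picard_mass_bound[OF assms] in blast)

text \<open>
  Monotone convergence carries Duhamel's formula over to the limit. Continuity in time is then read off
  from the formula, because an indefinite integral is continuous, and so is differentiability.
\<close>

lemma minimal_solution_integral_equation:
  fixes z defines "a \<equiv> V z - lattice_degree TYPE('d)"
  assumes "0 \<le> t"
  shows "(\<lambda>s. exp (- a * s) * (\<Sum>y\<in>nearest_neighbours z. minimal_solution V s y)) integrable_on {0..t}"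
    and "minimal_solution V t z = exp (a * t) * ((if z = 0 then 1 else 0) +
      integral {0..t} (\<lambda>s. exp (- a * s) * (\<Sum>y\<in>nearest_neighbours z. minimal_solution V s y)))"
proof -
  define f where "f = (\<lambda>n s. exp (- a * s) * (\<Sum>y\<in>nearest_neighbours z. picard V n s y))"
  define g where "g = (\<lambda>s. exp (- a * s) * (\<Sum>y\<in>nearest_neighbours z. minimal_solution V s y))"
  define \<delta> where "\<delta> = (if z = 0 then 1 else 0 :: real)"
  have "picard V (Suc n) t z = exp (a * t) * (\<delta> + integral {0..t} (f n))" for n
    unfolding picard.simps a_def[symmetric] f_def \<delta>_def by simp
  then have f_eq: "integral {0..t} (f n) = exp (- a * t) * picard V (Suc n) t z - \<delta>" for n
    by (simp add: exp_minus field_simps)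
  have lim: "(\<lambda>n. integral {0..t} (f n)) \<longlonglongrightarrow> exp (- a * t) * minimal_solution V t z - \<delta>"
    unfolding f_eq by (intro tendsto_intros LIMSEQ_Suc picard_tendsto assms)
  have *: "g integrable_on {0..t} \<and> ((\<lambda>n. integral {0..t} (f n)) \<longlongrightarrow> integral {0..t} g) sequentially"
  proof (rule monotone_convergence_increasing)
    show "f n integrable_on {0..t}" for n
      unfolding f_def by (rule picard_integrand_integrable)
    show "f n s \<le> f (Suc n) s" if "s \<in> {0..t}" for n s
      unfolding f_def using that by (intro mult_left_mono sum_mono picard_mono) auto
    show "(\<lambda>n. f n s) \<longlonglongrightarrow> g s" if "s \<in> {0..t}" for s
      unfolding f_def g_def using that by (intro tendsto_intros picard_tendsto) auto
    show "bounded (range (\<lambda>n. integral {0..t} (f n)))"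
      using lim convergent_imp_bounded by blast
  qed
  show "(\<lambda>s. exp (- a * s) * (\<Sum>y\<in>nearest_neighbours z. minimal_solution V s y)) integrable_on {0..t}"
    using * by (simp add: g_def)
  have "exp (- a * t) * minimal_solution V t z - \<delta> = integral {0..t} g"
    using LIMSEQ_unique[OF lim] * by blast
  then have "exp (a * t) * (exp (- a * t) * minimal_solution V t z) = exp (a * t) * (\<delta> + integral {0..t} g)"
    by simp
  then show "minimal_solution V t z = exp (a * t) * ((if z = 0 then 1 else 0) +
      integral {0..t} (\<lambda>s. exp (- a * s) * (\<Sum>y\<in>nearest_neighbours z. minimal_solution V s y)))"
    unfolding g_def \<delta>_def by (simp only: mult.assoc[symmetric] flip: exp_add) simp
qed

lemma minimal_solution_is_pam_solution: "is_pam_solution V (minimal_solution V)"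
proof -
  have cont: "continuous_on {0..} (\<lambda>t. minimal_solution V t z)" for z
  proof (rule continuous_on_halfline)
    fix b :: real assume b: "0 \<le> b"
    define a where "a = V z - lattice_degree TYPE('d)"
    have "continuous_on {0..b} (\<lambda>t. exp (a * t) * ((if z = 0 then 1 else 0) +
      integral {0..t} (\<lambda>s. exp (- a * s) * (\<Sum>y\<in>nearest_neighbours z. minimal_solution V s y))))"
      unfolding a_def
      by (intro continuous_intros indefinite_integral_continuous_1 minimal_solution_integral_equation(1) b)
    then show "continuous_on {0..b} (\<lambda>t. minimal_solution V t z)"
      by (rule continuous_on_eq) (simp add: minimal_solution_integral_equation(2)[of _ z] a_def)
  qed
  have deriv: "((\<lambda>s. minimal_solution V s z) has_real_derivative
        (discrete_laplacian (minimal_solution V t) z + V z * minimal_solution V t z)) (at t)"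
    if t: "0 < t" for t z
  proof -
    define a where "a = V z - lattice_degree TYPE('d)"
    define g where "g = (\<lambda>s. exp (- a * s) * (\<Sum>y\<in>nearest_neighbours z. minimal_solution V s y))"
    let ?\<delta> = "if z = 0 then 1 else 0 :: real"
    have eq: "minimal_solution V s z = exp (a * s) * (?\<delta> + integral {0..s} g)" if "0 \<le> s" for s
      using minimal_solution_integral_equation(2)[OF that, of z] unfolding a_def g_def .
    have "continuous_on {0..} g"
      unfolding g_def by (intro continuous_intros cont)
    from integral_derivative_halfline[OF this t]
    have "((\<lambda>s. ?\<delta> + integral {0..s} g) has_real_derivative 0 + g t) (at t)"
      by (intro DERIV_add DERIV_const)
    from has_derivative_exp_mult[OF this, of a]
    have d: "((\<lambda>s. exp (a * s) * (?\<delta> + integral {0..s} g)) has_real_derivative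
       exp (a * t) * (g t + a * (?\<delta> + integral {0..t} g))) (at t)" by simp
    have "exp (a * t) * (g t + a * (?\<delta> + integral {0..t} g))
        = exp (a * t) * g t + a * minimal_solution V t z"
      using eq[of t] t by (simp only: distrib_left mult.left_commute)
    also have "exp (a * t) * g t = (\<Sum>y\<in>nearest_neighbours z. minimal_solution V t y)"
      by (simp add: g_def exp_minus)
    also have "\<dots> + a * minimal_solution V t z
        = discrete_laplacian (minimal_solution V t) z + V z * minimal_solution V t z"
      by (simp add: discrete_laplacian_eq a_def algebra_simps)
    finally have "((\<lambda>s. exp (a * s) * (?\<delta> + integral {0..s} g)) has_real_derivative
        discrete_laplacian (minimal_solution V t) z + V z * minimal_solution V t z) (at t)"
      using d by simp
    moreover have "\<forall>\<^sub>F s in nhds t. exp (a * s) * (?\<delta> + integral {0..s} g) = minimal_solution V s z"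
      using eventually_nhds_in_open[of "{0<..}" t] t
      by (auto elim!: eventually_mono dest!: eq[OF less_imp_le])
    ultimately show ?thesis
      using DERIV_cong_ev[OF refl _ refl] by fastforce
  qed
  have "minimal_solution V 0 z = (if z = 0 then 1 else 0)" for z
    by (subst minimal_solution_integral_equation(2)) auto
  then show ?thesis
    unfolding is_pam_solution_def using cont deriv minimal_solution_nonneg
    by (auto simp: minimal_solution_def)
qed

lemma minimal_solution_le:
  assumes "is_pam_solution V v" "0 \<le> t"
  shows "minimal_solution V t z \<le> v t z"
  by (rule LIMSEQ_le_const2[OF picard_tendsto[OF assms(2)]])
     (use assms picard_le_solution[of V v t] in \<open>auto simp: is_pam_solution_iff\<close>)

end

section \<open>Uniqueness and the growth of the total mass\<close>

context
  fixes V :: "int ^ 'd::finite \<Rightarrow> real" and A c :: real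
  assumes V0: "\<And>z. 0 \<le> V z" and V_le: "\<And>z. V z \<le> A + c * norm1 z" and c: "0 \<le> c"
begin

text \<open>
  A solution that starts from zero can be nonzero at \<open>z\<close> only through mass that enters the ball of
  radius \<open>n\<close> from outside and makes at least \<open>n - norm1 z\<close> jumps inside it. Each jump improves the
  bound by one integration in time, hence the factor \<open>t ^ k / fact k\<close>.
\<close>

lemma iterated_upper_bound:
  assumes w: "nonneg_solution V w" and w0: "\<And>z. w 0 z = 0"
    and K: "\<And>z s. norm1 z \<le> n \<Longrightarrow> 0 \<le> s \<Longrightarrow> s \<le> T \<Longrightarrow> w s z \<le> K"
    and L: "\<And>z. norm1 z \<le> n \<Longrightarrow> V z \<le> L" "0 \<le> L"
    and z: "norm1 z + k \<le> n" and t: "0 \<le> t" "t \<le> T"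
  shows "w t z \<le> K * exp (L * t) * (lattice_degree TYPE('d) * t) ^ k / fact k"
  using z t
proof (induction k arbitrary: z t)
  case 0
  have "w t z \<le> K" using K 0 by simp
  moreover have "0 \<le> K" using K[of z t] nonneg_solution_nonneg[OF w, of t z] 0 by simp
  ultimately have "w t z * 1 \<le> K * exp (L * t)"
    using 0 L by (intro mult_mono) auto
  then show ?case by simp
next
  case (Suc k)
  let ?D = "lattice_degree TYPE('d)"
  have "K * (?D * 0) ^ Suc k / fact (Suc k) - exp (- L * 0) * w 0 z
     \<le> K * (?D * t) ^ Suc k / fact (Suc k) - exp (- L * t) * w t z"
  proof (rule DERIV_nonneg_imp_increasing_open[where f = "\<lambda>s. K * (?D * s) ^ Suc k / fact (Suc k) - exp (- L * s) * w s z"])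
    show "0 \<le> t" using Suc.prems by simp
    show "continuous_on {0..t} (\<lambda>s. K * (?D * s) ^ Suc k / fact (Suc k) - exp (- L * s) * w s z)"
      by (intro continuous_intros nonneg_solution_continuous[OF w]) auto
    fix s assume s: "0 < s" "s < t"
    let ?w' = "(\<Sum>y\<in>nearest_neighbours z. w s y) + (V z - ?D) * w s z"
    have d1: "((\<lambda>s. K * (?D * s) ^ Suc k / fact (Suc k)) has_real_derivative K * ?D * (?D * s) ^ k / fact k) (at s)"
      using DERIV_cmult_right[OF DERIV_pow[of "Suc k" s], of "K * ?D ^ Suc k / fact (Suc k)"]
      by (simp add: divide_simps power_mult_distrib mult_ac del: of_nat_Suc)
    have d2: "((\<lambda>s. exp (- L * s) * w s z) has_real_derivative exp (- L * s) * (?w' + - L * w s z)) (at s)"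
      by (rule has_derivative_exp_mult[OF nonneg_solution_derivative[OF w s(1)]])
    have "(\<Sum>y\<in>nearest_neighbours z. w s y) \<le> (\<Sum>y\<in>nearest_neighbours z. K * exp (L * s) * (?D * s) ^ k / fact k)"
      using Suc.prems s nearest_neighbours_norm1(1) by (intro sum_mono Suc.IH) fastforce+
    also have "\<dots> = exp (L * s) * (K * ?D * (?D * s) ^ k / fact k)"
      by (simp add: card_nearest_neighbours)
    finally have 1: "(\<Sum>y\<in>nearest_neighbours z. w s y) \<le> exp (L * s) * (K * ?D * (?D * s) ^ k / fact k)" .
    have "(V z - ?D) * w s z \<le> L * w s z"
    proof (rule mult_right_mono)
      have "V z \<le> L" using L(1)[of z] Suc.prems by simp
      then show "V z - ?D \<le> L" using lattice_degree_nonneg[where 'd='d] by linarith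
    qed (use nonneg_solution_nonneg[OF w] s in auto)
    with 1 have "?w' + - L * w s z \<le> exp (L * s) * (K * ?D * (?D * s) ^ k / fact k)" by linarith
    then have "exp (- L * s) * (?w' + - L * w s z) \<le> exp (- L * s) * (exp (L * s) * (K * ?D * (?D * s) ^ k / fact k))"
      by (intro mult_left_mono) auto
    also have "\<dots> = K * ?D * (?D * s) ^ k / fact k"
      by (simp add: exp_minus)
    finally show "\<exists>y. ((\<lambda>s. K * (?D * s) ^ Suc k / fact (Suc k) - exp (- L * s) * w s z) has_real_derivative y) (at s) \<and> 0 \<le> y"
      using DERIV_diff[OF d1 d2] by (intro exI conjI) (assumption, linarith)
  qed
  then have "exp (L * t) * (exp (- L * t) * w t z) \<le> exp (L * t) * (K * (?D * t) ^ Suc k / fact (Suc k))"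
    by (intro mult_left_mono) (auto simp: w0)
  then show ?case by (simp add: exp_minus mult_ac)
qed

text \<open>
  Chosen such that \<open>2 * (2d) * \<delta> * exp (c * \<delta>) \<le> 1 / 2\<close> holds for this time \<open>\<delta>\<close>.
\<close>

definition uniqueness_time :: real where
  "uniqueness_time = 1 / (4 * (lattice_degree TYPE('d) + 1) * exp c)"

lemma uniqueness_time_bounds: "0 < uniqueness_time" "uniqueness_time \<le> 1 / 2"
proof -
  have D: "0 \<le> lattice_degree TYPE('d)" by simp
  show "0 < uniqueness_time"
    unfolding uniqueness_time_def using D by (intro divide_pos_pos mult_pos_pos add_nonneg_pos) auto
  have "4 * 1 * 1 \<le> 4 * (lattice_degree TYPE('d) + 1) * exp c"
    using D c by (intro mult_mono) auto
  then show "uniqueness_time \<le> 1 / 2"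
    unfolding uniqueness_time_def by (intro divide_left_mono) auto
qed

text \<open>
  Two factorials cancel. Since the value at the origin at time \<open>1\<close> is finite, the solution is at most
  of order \<open>fact n * 2 ^ n\<close> in the ball of radius \<open>n\<close> up to time \<open>1 / 2\<close>; iterating \<open>n\<close> times
  multiplies this by \<open>(2d * \<delta>) ^ n / fact n\<close>, and the potential costs only
  \<open>exp ((\<bar>A\<bar> + c * n) * \<delta>)\<close> because it grows at most linearly. What remains is geometrically
  small in \<open>n\<close>. So the solution vanishes at the origin at time \<open>\<delta>\<close>, and hence everywhere
  before.
\<close>

lemma nonneg_solution_zero_short_time:
  assumes w: "nonneg_solution V w" and w0: "\<And>z. w 0 z = 0"
    and t: "0 \<le> t" "t < uniqueness_time"
  shows "w t z = 0"
proof -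
  let ?D = "lattice_degree TYPE('d)"
  let ?\<delta> = uniqueness_time
  have \<delta>: "0 < ?\<delta>" "?\<delta> \<le> 1 / 2" by (fact uniqueness_time_bounds)+
  define C where "C = w 1 0 * exp ?D * exp (\<bar>A\<bar> * ?\<delta>)"
  have C0: "0 \<le> C" unfolding C_def using nonneg_solution_nonneg[OF w] by simp
  have "w ?\<delta> 0 \<le> C * (1 / 2) ^ n" for n
  proof -
    define K where "K = w 1 0 * exp ?D * fact n * 2 ^ n"
    define L where "L = \<bar>A\<bar> + c * n"
    have K: "w s y \<le> K" if "norm1 y \<le> n" "0 \<le> s" "s \<le> ?\<delta>" for y s
    proof -
      have s: "1 / 2 \<le> 1 - s" "1 - s \<le> 1" using that \<delta> by auto
      have "exp (- ?D * (1 - s)) * (1 - s) ^ norm1 (0 - y) / fact (norm1 (0 - y)) * w (s + 0) y \<le> w (s + (1 - s)) 0"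
        using s by (intro nonneg_solution_spread[OF nonneg_solution_shift[OF w that(2)] V0]) auto
      then have "exp (- ?D * (1 - s)) * (1 - s) ^ norm1 y / fact (norm1 y) * w s y \<le> w 1 0"
        by (simp add: norm1_minus_commute[of 0 y, simplified])
      moreover have "exp (- ?D) * (1 / 2) ^ n / fact n \<le> exp (- ?D * (1 - s)) * (1 - s) ^ norm1 y / fact (norm1 y)"
      proof -
        have "?D * (1 - s) \<le> ?D * 1" using s by (intro mult_left_mono) auto
        then have 1: "exp (- ?D) \<le> exp (- ?D * (1 - s))" by simp
        have "(1 / 2) ^ n \<le> (1 / 2 :: real) ^ norm1 y"
          using that by (intro power_decreasing) auto
        also have "\<dots> \<le> (1 - s) ^ norm1 y" using s by (intro power_mono) auto
        finally have 2: "(1 / 2) ^ n \<le> (1 - s) ^ norm1 y" .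
        have 3: "fact (norm1 y) \<le> (fact n :: real)"
          using that by (intro fact_mono) auto
        have "0 \<le> exp (- ?D * (1 - s)) * (1 - s) ^ norm1 y" using s by simp
        moreover have "exp (- ?D) * (1 / 2) ^ n \<le> exp (- ?D * (1 - s)) * (1 - s) ^ norm1 y"
          using 1 2 by (rule mult_mono) auto
        ultimately show ?thesis
          using 3 by (intro frac_le) auto
      qed
      ultimately have "exp (- ?D) * (1 / 2) ^ n / fact n * w s y \<le> w 1 0"
        using nonneg_solution_nonneg[OF w that(2), of y] by (meson mult_right_mono order_trans)
      then have "exp ?D * fact n * 2 ^ n * (exp (- ?D) * (1 / 2) ^ n / fact n * w s y) \<le> exp ?D * fact n * 2 ^ n * w 1 0"
        by (intro mult_left_mono) auto
      moreover have "exp ?D * fact n * 2 ^ n * (exp (- ?D) * (1 / 2) ^ n / fact n * w s y) = w s y"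
        by (simp add: exp_minus power_one_over)
      moreover have "K = exp ?D * fact n * 2 ^ n * w 1 0" by (simp add: K_def mult_ac)
      ultimately show ?thesis by linarith
    qed
    have "w ?\<delta> 0 \<le> K * exp (L * ?\<delta>) * (?D * ?\<delta>) ^ n / fact n"
    proof (rule iterated_upper_bound[OF w w0, where n = n and k = n and z = 0 and T = ?\<delta> and L = L and K = K and t = ?\<delta>])
      show "w s y \<le> K" if "norm1 y \<le> n" "0 \<le> s" "s \<le> ?\<delta>" for y s
        using K that by blast
      show "V z \<le> L" if "norm1 z \<le> n" for z
      proof -
        have "V z \<le> A + c * norm1 z" by (rule V_le)
        also have "\<dots> \<le> L" unfolding L_def using that c by (intro add_mono mult_left_mono) auto
        finally show ?thesis .
      qed
      show "0 \<le> L" using c by (simp add: L_def)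
    qed (use \<delta> in auto)
    also have "\<dots> = C * (2 * ?D * ?\<delta> * exp (c * ?\<delta>)) ^ n"
      by (simp add: K_def C_def L_def distrib_left exp_add power_mult_distrib exp_of_nat_mult[symmetric] mult_ac)
    also have "\<dots> \<le> C * (1 / 2) ^ n"
    proof (intro mult_left_mono power_mono C0)
      have D: "0 \<le> ?D" by simp
      have "exp (c * ?\<delta>) \<le> exp (c * 1)" using \<delta> c by (subst exp_le_cancel_iff, intro mult_left_mono) auto
      then have "2 * ?D * ?\<delta> * exp (c * ?\<delta>) \<le> 2 * (?D + 1) * ?\<delta> * exp c"
        using \<delta> D by (intro mult_mono) auto
      also have "\<dots> = 1 / 2"
        unfolding uniqueness_time_def using D by (simp add: field_simps add_nonneg_eq_0_iff)
      finally show "2 * ?D * ?\<delta> * exp (c * ?\<delta>) \<le> 1 / 2" .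
      show "0 \<le> 2 * ?D * ?\<delta> * exp (c * ?\<delta>)" using \<delta> D by simp
    qed
    finally show ?thesis .
  qed
  moreover have "(\<lambda>n. C * (1 / 2) ^ n) \<longlonglongrightarrow> C * 0"
    by (intro tendsto_mult tendsto_const LIMSEQ_realpow_zero) auto
  ultimately have "w ?\<delta> 0 \<le> C * 0"
    by (intro LIMSEQ_le_const) blast+
  then have \<delta>0: "w ?\<delta> 0 \<le> 0" by simp
  have "exp (- ?D * (?\<delta> - t)) * (?\<delta> - t) ^ norm1 (0 - z) / fact (norm1 (0 - z)) * w (t + 0) z \<le> w (t + (?\<delta> - t)) 0"
    using t by (intro nonneg_solution_spread[OF nonneg_solution_shift[OF w t(1)] V0]) auto
  then have "exp (- ?D * (?\<delta> - t)) * (?\<delta> - t) ^ norm1 (0 - z) / fact (norm1 (0 - z)) * w t z \<le> 0"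
    using \<delta>0 by simp
  moreover have "0 < exp (- ?D * (?\<delta> - t)) * (?\<delta> - t) ^ norm1 (0 - z) / fact (norm1 (0 - z))"
    using t by simp
  ultimately have "w t z \<le> 0" by (meson mult_pos_pos not_le)
  then show ?thesis using nonneg_solution_nonneg[OF w t(1), of z] by simp
qed

text \<open>
  The time gained does not depend on the solution, so the argument can be restarted.
\<close>

lemma nonneg_solution_zero:
  assumes w: "nonneg_solution V w" and w0: "\<And>z. w 0 z = 0" and t: "0 \<le> t"
  shows "w t z = 0"
proof -
  let ?e = "uniqueness_time / 2"
  have e: "0 < ?e" using uniqueness_time_bounds by simp
  have *: "\<forall>t z. 0 \<le> t \<longrightarrow> t \<le> real m * ?e \<longrightarrow> w t z = 0" for m
  proof (induction m)
    case 0
    then show ?case using w0 by auto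
  next
    case (Suc m)
    show ?case
    proof (intro allI impI)
      fix t z assume t: "0 \<le> t" "t \<le> real (Suc m) * ?e"
      show "w t z = 0"
      proof (cases "t \<le> real m * ?e")
        case False
        define r where "r = real m * ?e"
        have r: "0 \<le> r" using e by (simp add: r_def)
        have "w (r + (t - r)) z = 0"
        proof (rule nonneg_solution_zero_short_time[OF nonneg_solution_shift[OF w r]])
          show "w (r + 0) z = 0" for z using Suc r by (simp add: r_def)
          show "0 \<le> t - r" using False by (simp add: r_def)
          show "t - r < uniqueness_time" using t e by (simp add: r_def algebra_simps)
        qed
        then show ?thesis by simp
      qed (use Suc t in auto)
    qed
  qed
  obtain m where "t / ?e \<le> real m" using real_arch_simple by blast
  then have "t \<le> real m * ?e" using e by (simp add: divide_le_eq)
  then show ?thesis using * t by blast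
qed

lemma is_pam_solution_unique:
  assumes v: "is_pam_solution V v"
  shows "v = minimal_solution V"
proof -
  let ?u = "minimal_solution V"
  note u = minimal_solution_is_pam_solution[OF V_le c]
  have "nonneg_solution V (\<lambda>t z. v t z - ?u t z)"
    unfolding nonneg_solution_def
  proof (intro conjI allI impI)
    show "0 \<le> v t z - ?u t z" if "0 \<le> t" for t z
      using minimal_solution_le[OF V_le c v that] by simp
    show "continuous_on {0..} (\<lambda>t. v t z - ?u t z)" for z
      using u v unfolding is_pam_solution_def by (intro continuous_intros) auto
    show "((\<lambda>s. v s z - ?u s z) has_real_derivative
        discrete_laplacian (\<lambda>z. v t z - ?u t z) z + V z * (v t z - ?u t z)) (at t)" if "0 < t" for t z
    proof -
      have "discrete_laplacian (\<lambda>z. v t z - ?u t z) z = discrete_laplacian (v t) z - discrete_laplacian (?u t) z"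
        by (simp add: discrete_laplacian_eq sum_subtractf algebra_simps)
      moreover have "((\<lambda>s. v s z - ?u s z) has_real_derivative
        (discrete_laplacian (v t) z + V z * v t z) - (discrete_laplacian (?u t) z + V z * ?u t z)) (at t)"
        using u v that unfolding is_pam_solution_def by (intro DERIV_diff) auto
      moreover have "(discrete_laplacian (v t) z + V z * v t z) - (discrete_laplacian (?u t) z + V z * ?u t z)
          = discrete_laplacian (v t) z - discrete_laplacian (?u t) z + V z * (v t z - ?u t z)"
        by (simp add: algebra_simps)
      ultimately show ?thesis by simp
    qed
  qed
  moreover have "v 0 z - ?u 0 z = 0" for z
    using u v by (simp add: is_pam_solution_def)
  ultimately have "v t z - ?u t z = 0" if "0 \<le> t" for t z
    using nonneg_solution_zero[of "\<lambda>t z. v t z - ?u t z"] that by blast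
  moreover have "v t z = ?u t z" if "t < 0" for t z
    using u v that by (simp add: is_pam_solution_def)
  ultimately show ?thesis
    by (intro ext) (case_tac "x < 0", auto)
qed

lemma pam_solution_eq: "pam_solution V = minimal_solution V"
  unfolding pam_solution_def
  by (rule the_equality[where P = "is_pam_solution V", OF minimal_solution_is_pam_solution[OF V_le c]])
     (rule is_pam_solution_unique)

lemma pam_solution_summable:
  assumes "0 \<le> t"
  shows "pam_solution V t summable_on UNIV"
  unfolding pam_solution_eq
proof (rule nonneg_bdd_above_summable_on)
  show "bdd_above (sum (minimal_solution V t) ` {F. F \<subseteq> UNIV \<and> finite F})"
  proof (rule bdd_aboveI2)
    fix F :: "(int ^ 'd) set" assume "F \<in> {F. F \<subseteq> UNIV \<and> finite F}"
    then have "finite F" by simp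
    then show "sum (minimal_solution V t) F \<le> exp (t * (A + lattice_degree TYPE('d) * exp (c * t)))"
      by (rule minimal_solution_sum_le[OF V_le c V_le c assms])
  qed
qed (rule minimal_solution_nonneg[OF V_le c assms])

lemma pam_total_mass_ge:
  assumes "0 \<le> t"
  shows "pam_solution V t z \<le> pam_total_mass V t"
  unfolding pam_total_mass_def
proof -
  have "sum (pam_solution V t) {z} \<le> infsum (pam_solution V t) UNIV"
  proof (rule finite_sum_le_infsum[OF pam_solution_summable[OF assms]])
    show "0 \<le> pam_solution V t x" for x
      unfolding pam_solution_eq by (rule minimal_solution_nonneg[OF V_le c assms])
  qed auto
  then show "pam_solution V t z \<le> infsum (pam_solution V t) UNIV" by simp
qed

lemma pam_total_mass_le:
  fixes lam h t :: real
  assumes "\<And>z. V z \<le> lam + h * norm1 z" "0 \<le> h" "0 \<le> t"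
  shows "pam_total_mass V t \<le> exp (t * (lam + lattice_degree TYPE('d) * exp (h * t)))"
  unfolding pam_total_mass_def
proof (rule infsum_le_finite_sums[OF pam_solution_summable[OF assms(3)]])
  fix F :: "(int ^ 'd) set" assume "finite F"
  then show "sum (pam_solution V t) F \<le> exp (t * (lam + lattice_degree TYPE('d) * exp (h * t)))"
    unfolding pam_solution_eq by (rule minimal_solution_sum_le[OF V_le c assms])
qed

text \<open>
  Half of the time is spent on reaching \<open>z\<close>, the other half on staying there. Giving up half of
  the peak costs a constant factor in the growth rate.
\<close>

lemma pam_total_mass_lower_bound:
  assumes t: "0 \<le> t"
  shows "exp (V z * t / 2 - lattice_degree TYPE('d) * t) * (t / 2) ^ norm1 z / fact (norm1 z) \<le> pam_total_mass V t"
proof -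
  let ?D = "lattice_degree TYPE('d)" and ?u = "minimal_solution V"
  have u: "nonneg_solution V ?u" "?u 0 0 = 1"
    using minimal_solution_is_pam_solution[OF V_le c] by (auto simp: is_pam_solution_iff)
  have "exp (V z * t / 2 - ?D * t) * (t / 2) ^ norm1 z / fact (norm1 z)
     = exp ((V z - ?D) * (t - t / 2)) * (exp (- ?D * (t / 2)) * (t / 2) ^ norm1 (z - 0) / fact (norm1 (z - 0)) * ?u 0 0)"
  proof -
    have "V z * t / 2 - ?D * t = (V z - ?D) * (t - t / 2) + - ?D * (t / 2)"
      by (simp add: field_simps)
    then have "exp (V z * t / 2 - ?D * t) = exp ((V z - ?D) * (t - t / 2)) * exp (- ?D * (t / 2))"
      by (simp only: exp_add)
    then show ?thesis by (simp only: u) simp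
  qed
  also have "\<dots> \<le> exp ((V z - ?D) * (t - t / 2)) * ?u (t / 2) z"
    using t by (intro mult_left_mono nonneg_solution_spread[OF u(1) V0]) auto
  also have "\<dots> \<le> ?u t z"
    using t by (intro nonneg_solution_stay[OF u(1)]) auto
  also have "\<dots> \<le> pam_total_mass V t"
    using pam_total_mass_ge[OF t] by (simp add: pam_solution_eq)
  finally show ?thesis .
qed

text \<open>
  From time \<open>2\<close> on, the power \<open>(t / 2) ^ norm1 z\<close> is at least \<open>1\<close> and is dropped.
\<close>

lemma pam_growth_rate_lower_bound:
  assumes t: "2 \<le> t"
  shows "V z / 2 - lattice_degree TYPE('d) - norm1 z * ln (norm1 z) / t \<le> pam_growth_rate V t"
proof -
  let ?D = "lattice_degree TYPE('d)" and ?n = "norm1 z"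
  have fact: "fact ?n \<le> exp (?n * ln ?n)"
  proof (cases "?n = 0")
    case False
    have "(fact ?n :: real) \<le> real (?n ^ ?n)" by (rule fact_le_power)
    also have "\<dots> = exp (?n * ln ?n)" using False by (subst exp_of_nat_mult) (simp add: neq0_conv[symmetric] del: neq0_conv)
    finally show ?thesis .
  qed simp
  have "exp (V z * t / 2 - ?D * t - ?n * ln ?n) = exp (V z * t / 2 - ?D * t) * 1 / exp (?n * ln ?n)"
    by (simp add: exp_diff)
  also have "\<dots> \<le> exp (V z * t / 2 - ?D * t) * (t / 2) ^ ?n / fact ?n"
    using t fact by (intro frac_le mult_left_mono one_le_power) auto
  also have "\<dots> \<le> pam_total_mass V t"
    using t by (intro pam_total_mass_lower_bound) auto
  finally have "V z * t / 2 - ?D * t - ?n * ln ?n \<le> ln (pam_total_mass V t)"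
    by (subst ln_ge_iff) (auto intro: less_le_trans[OF exp_gt_zero])
  then have "(V z * t / 2 - ?D * t - ?n * ln ?n) / t \<le> ln (pam_total_mass V t) / t"
    using t by (intro divide_right_mono) auto
  then show ?thesis
    using t by (simp add: pam_growth_rate_def diff_divide_distrib)
qed

lemma pam_growth_rate_upper_bound:
  fixes lam h t :: real
  assumes V: "\<And>z. V z \<le> lam + h * norm1 z" and h: "0 \<le> h" and t: "0 < t"
  shows "pam_growth_rate V t \<le> lam + lattice_degree TYPE('d) * exp (h * t)"
proof -
  have "0 < exp (V 0 * t / 2 - lattice_degree TYPE('d) * t) * (t / 2) ^ norm1 (0 :: int ^ 'd) / fact (norm1 (0 :: int ^ 'd))"
    by simp
  also have "\<dots> \<le> pam_total_mass V t" using t by (intro pam_total_mass_lower_bound) auto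
  finally have "ln (pam_total_mass V t) \<le> t * (lam + lattice_degree TYPE('d) * exp (h * t))"
    using pam_total_mass_le[OF V h, of t] t by (subst ln_exp[symmetric], subst ln_le_cancel_iff) auto
  then show ?thesis
    using t by (simp add: pam_growth_rate_def divide_le_eq mult.commute)
qed

end

section \<open>Dyadic boxes and corners\<close>

text \<open>
  Boxes cover the lattice and serve the upper bounds on the potential.
\<close>

definition dyadic_box :: "nat \<Rightarrow> (int ^ 'd::finite) set" where
  "dyadic_box j = {z. \<forall>i. z $ i \<in> {- (2 ^ j)..2 ^ j}}"

text \<open>
  Corners serve the lower bounds: a corner is as large as the box of the same scale up to a constant
  factor, and corners of different scales are disjoint, so the potential on them is independent.
\<close>

definition dyadic_corner :: "nat \<Rightarrow> (int ^ 'd::finite) set" where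
  "dyadic_corner j = {z. \<forall>i. z $ i \<in> {2 ^ j<..2 ^ Suc j}}"

lemma finite_dyadic_box: "finite (dyadic_box j)"
  unfolding dyadic_box_def by (rule finite_vec_set) simp

lemma finite_dyadic_corner: "finite (dyadic_corner j)"
  unfolding dyadic_corner_def by (rule finite_vec_set) simp

lemma card_dyadic_box_le: "real (card (dyadic_box j :: (int ^ 'd::finite) set)) \<le> 3 ^ CARD('d) * (2 ^ j) ^ CARD('d)"
proof -
  have "card {- (2 ^ j)..(2 :: int) ^ j} = nat (2 * 2 ^ j + 1)"
    by simp
  then have "real (card {- (2 ^ j)..(2 :: int) ^ j}) = 2 * 2 ^ j + 1" by simp
  also have "\<dots> \<le> 3 * 2 ^ j" using one_le_power[of "2 :: real" j] by simp
  finally have "real (card {- (2 ^ j)..(2 :: int) ^ j}) ^ CARD('d) \<le> (3 * 2 ^ j) ^ CARD('d)"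
    by (intro power_mono) auto
  then show ?thesis
    unfolding dyadic_box_def card_vec_set of_nat_power power_mult_distrib .
qed

lemma card_dyadic_corner: "real (card (dyadic_corner j :: (int ^ 'd::finite) set)) = (2 ^ j) ^ CARD('d)"
proof -
  have "card {(2 :: int) ^ j<..2 ^ Suc j} = nat (2 ^ j)" by simp
  then have "real (card {(2 :: int) ^ j<..2 ^ Suc j}) = 2 ^ j" by simp
  then show ?thesis
    unfolding dyadic_corner_def card_vec_set of_nat_power by simp
qed

lemma dyadic_corner_disjoint: "j \<noteq> k \<Longrightarrow> dyadic_corner j \<inter> dyadic_corner k = {}"
proof -
  have *: "dyadic_corner j \<inter> dyadic_corner k = ({} :: (int ^ 'd) set)" if "j < k" for j k :: nat
  proof -
    have "(2 :: int) ^ Suc j \<le> 2 ^ k" using that by (intro power_increasing) auto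
    then have "z \<notin> dyadic_corner k" if "z \<in> dyadic_corner j" for z :: "int ^ 'd"
      using that unfolding dyadic_corner_def by (auto simp: not_less intro: order_trans)
    then show ?thesis by blast
  qed
  show "dyadic_corner j \<inter> dyadic_corner k = {}" if "j \<noteq> k"
    using that *[of j k] *[of k j] by (cases j k rule: linorder_cases) auto
qed

lemma norm1_dyadic_corner: "z \<in> dyadic_corner j \<Longrightarrow> norm1 (z :: int ^ 'd::finite) \<le> CARD('d) * 2 ^ Suc j"
proof -
  assume z: "z \<in> dyadic_corner j"
  have "int (norm1 z) \<le> (\<Sum>i\<in>(UNIV :: 'd set). 2 ^ Suc j)"
    unfolding int_norm1
  proof (rule sum_mono)
    fix i
    have "(2 :: int) ^ j < z $ i" "z $ i \<le> 2 ^ Suc j" using z by (auto simp: dyadic_corner_def)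
    moreover have "(0 :: int) < 2 ^ j" by simp
    ultimately show "\<bar>z $ i\<bar> \<le> 2 ^ Suc j" by linarith
  qed
  also have "\<dots> = int (CARD('d) * 2 ^ Suc j)" by simp
  finally show ?thesis by linarith
qed

lemma norm1_not_in_dyadic_box:
  assumes "z \<notin> dyadic_box j"
  shows "2 ^ j < real (norm1 z)"
proof -
  obtain i where "\<not> (- (2 ^ j) \<le> z $ i \<and> z $ i \<le> 2 ^ j)"
    using assms by (auto simp: dyadic_box_def)
  then have "2 ^ j < \<bar>z $ i\<bar>" by linarith
  then have "2 ^ j < int (norm1 z)" using abs_component_le_norm1[of z i] by linarith
  then show ?thesis by (metis of_int_less_iff of_int_of_nat_eq of_int_power of_int_numeral)
qed

lemma in_some_dyadic_box: "\<exists>j\<ge>k. z \<in> dyadic_box j"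
proof -
  define j where "j = max k (norm1 z)"
  have "norm1 z < 2 ^ j" using le_less_trans[OF _ less_exp[of j], of "norm1 z"] by (simp add: j_def)
  then have "int (norm1 z) < 2 ^ j" by (metis of_nat_less_iff of_nat_numeral of_nat_power)
  then have "\<bar>z $ i\<bar> < 2 ^ j" for i using abs_component_le_norm1[of z i] by linarith
  then have "- (2 ^ j) \<le> z $ i \<and> z $ i \<le> 2 ^ j" for i
    using abs_le_iff[of "z $ i" "2 ^ j"] by (simp add: less_imp_le minus_le_iff)
  then have "z \<in> dyadic_box j" by (simp add: dyadic_box_def)
  then show ?thesis by (intro exI[of _ j]) (simp add: j_def)
qed

lemma dyadic_shell:
  assumes "z \<notin> dyadic_box k"
  obtains j where "k \<le> j" "z \<notin> dyadic_box j" "z \<in> dyadic_box (Suc j)"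
proof -
  define m where "m = (LEAST m. k \<le> m \<and> z \<in> dyadic_box m)"
  have m: "k \<le> m" "z \<in> dyadic_box m"
    using LeastI_ex[of "\<lambda>m. k \<le> m \<and> z \<in> dyadic_box m"] in_some_dyadic_box[of k z] by (auto simp: m_def)
  with assms have "m \<noteq> k" by auto
  with m have "k \<le> m - 1" "m - 1 < m" by auto
  moreover have "\<not> (k \<le> m - 1 \<and> z \<in> dyadic_box (m - 1))"
    using not_less_Least[of "m - 1" "\<lambda>m. k \<le> m \<and> z \<in> dyadic_box m"] \<open>m - 1 < m\<close> by (simp add: m_def)
  ultimately show thesis using that[of "m - 1"] m by (metis Suc_diff_1 gr_zeroI less_zeroE)
qed

section \<open>Extremes of a Pareto field\<close>

locale pareto_field = prob_space M for M :: "'w measure" +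
  fixes \<xi> :: "int ^ 'd::finite \<Rightarrow> 'w \<Rightarrow> real" and \<alpha> :: real
  assumes indep: "indep_vars (\<lambda>_. borel) \<xi> UNIV"
    and cdf: "\<And>z x. prob {\<omega> \<in> space M. \<xi> z \<omega> \<le> x} = (if x < 1 then 0 else 1 - x powr (- \<alpha>))"
    and alpha: "real CARD('d) < \<alpha>"
begin

lemma measurable_xi [measurable]: "\<xi> z \<in> borel_measurable M"
  using indep by (auto simp: indep_vars_def)

lemma alpha_pos: "0 < \<alpha>" using alpha by linarith

lemma prob_exceeds: "1 \<le> x \<Longrightarrow> prob {\<omega> \<in> space M. x < \<xi> z \<omega>} = x powr (- \<alpha>)"
  using prob_neg[of "\<lambda>\<omega>. \<xi> z \<omega> \<le> x"] cdf[of z x] by (simp add: not_le)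

lemma AE_nonneg: "AE \<omega> in M. \<forall>z. 0 \<le> \<xi> z \<omega>"
  unfolding AE_all_countable
proof
  fix z
  have "emeasure M {\<omega> \<in> space M. \<xi> z \<omega> \<le> 0} = 0"
    using cdf[of z 0] by (simp add: emeasure_eq_measure)
  then have "AE \<omega> in M. \<not> \<xi> z \<omega> \<le> 0"
    by (subst AE_iff_measurable[OF _ refl]) auto
  then show "AE \<omega> in M. 0 \<le> \<xi> z \<omega>" by (rule AE_mp) simp
qed

lemma prob_some_exceeds_le:
  assumes S: "finite S" and x: "1 \<le> x"
  shows "prob {\<omega> \<in> space M. \<exists>z\<in>S. x < \<xi> z \<omega>} \<le> card S * x powr (- \<alpha>)"
proof -
  have "prob {\<omega> \<in> space M. \<exists>z\<in>S. x < \<xi> z \<omega>} = prob (\<Union>z\<in>S. {\<omega> \<in> space M. x < \<xi> z \<omega>})"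
    by (rule arg_cong[where f = prob]) auto
  also have "\<dots> \<le> (\<Sum>z\<in>S. prob {\<omega> \<in> space M. x < \<xi> z \<omega>})"
    by (rule finite_measure_subadditive_finite[OF S]) auto
  also have "\<dots> = card S * x powr (- \<alpha>)" by (simp add: prob_exceeds x)
  finally show ?thesis .
qed

lemma prob_none_exceeds_le:
  assumes S: "finite S" and f: "\<And>z. z \<in> S \<Longrightarrow> 1 \<le> f z"
  shows "prob {\<omega> \<in> space M. \<forall>z\<in>S. \<xi> z \<omega> \<le> f z} \<le> exp (- (\<Sum>z\<in>S. f z powr (- \<alpha>)))"
proof (cases "S = {}")
  case False
  have "{\<omega> \<in> space M. \<forall>z\<in>S. \<xi> z \<omega> \<le> f z} = (\<Inter>z\<in>S. \<xi> z -` {..f z} \<inter> space M)"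
    using False by auto
  then have "prob {\<omega> \<in> space M. \<forall>z\<in>S. \<xi> z \<omega> \<le> f z} = (\<Prod>z\<in>S. prob (\<xi> z -` {..f z} \<inter> space M))"
    using indep_varsD_finite[OF indep_vars_subset[OF indep subset_UNIV] False S, of "\<lambda>z. {..f z}"] by simp
  also have "\<dots> = (\<Prod>z\<in>S. 1 - f z powr (- \<alpha>))"
  proof (rule prod.cong[OF refl])
    fix z assume "z \<in> S"
    have "\<xi> z -` {..f z} \<inter> space M = {\<omega> \<in> space M. \<xi> z \<omega> \<le> f z}" by auto
    then show "prob (\<xi> z -` {..f z} \<inter> space M) = 1 - f z powr (- \<alpha>)"
      using cdf[of z "f z"] f[OF \<open>z \<in> S\<close>] by simp
  qed
  also have "\<dots> \<le> (\<Prod>z\<in>S. exp (- (f z powr (- \<alpha>))))"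
  proof (rule prod_mono)
    fix z assume "z \<in> S"
    have "f z powr (- \<alpha>) \<le> 1 powr (- \<alpha>)"
      using f[OF \<open>z \<in> S\<close>] alpha_pos by (intro powr_mono2') auto
    then show "0 \<le> 1 - f z powr (- \<alpha>) \<and> 1 - f z powr (- \<alpha>) \<le> exp (- (f z powr (- \<alpha>)))"
      using exp_ge_add_one_self[of "- (f z powr (- \<alpha>))"] by simp
  qed
  also have "\<dots> = exp (- (\<Sum>z\<in>S. f z powr (- \<alpha>)))"
    by (simp add: exp_sum[OF S] sum_negf[symmetric])
  finally show ?thesis .
qed simp

text \<open>
  The convergent half of the Borel-Cantelli lemma, with a union bound over each box.
\<close>

lemma AE_eventually_below:
  assumes a: "\<forall>\<^sub>F j in sequentially. 1 \<le> a j"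
    and sum: "summable (\<lambda>j. (2 ^ j) ^ CARD('d) * a j powr (- \<alpha>))"
  shows "AE \<omega> in M. \<forall>\<^sub>F j in sequentially. \<forall>z\<in>dyadic_box j. \<xi> z \<omega> \<le> a j"
proof -
  define E where "E = (\<lambda>j. {\<omega> \<in> space M. \<exists>z\<in>dyadic_box j. a j < \<xi> z \<omega>})"
  have meas: "E j \<in> sets M" for j
  proof -
    have "E j = (\<Union>z\<in>dyadic_box j. {\<omega> \<in> space M. a j < \<xi> z \<omega>})" by (auto simp: E_def)
    also have "\<dots> \<in> sets M" by (intro sets.finite_UN finite_dyadic_box) measurable
    finally show ?thesis .
  qed
  have "AE \<omega> in M. \<forall>\<^sub>F j in sequentially. \<omega> \<in> space M - E j"
  proof (rule borel_cantelli_AE1[OF meas])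
    show "summable (\<lambda>j. prob (E j))"
    proof (rule summable_comparison_test_ev)
      show "summable (\<lambda>j. 3 ^ CARD('d) * ((2 ^ j) ^ CARD('d) * a j powr (- \<alpha>)))"
        by (rule summable_mult[OF sum])
      show "\<forall>\<^sub>F j in sequentially. norm (prob (E j)) \<le> 3 ^ CARD('d) * ((2 ^ j) ^ CARD('d) * a j powr (- \<alpha>))"
        using a
      proof eventually_elim
        case (elim j)
        have "prob (E j) \<le> card (dyadic_box j :: (int ^ 'd) set) * a j powr (- \<alpha>)"
          unfolding E_def by (rule prob_some_exceeds_le[OF finite_dyadic_box elim])
        also have "\<dots> \<le> 3 ^ CARD('d) * (2 ^ j) ^ CARD('d) * a j powr (- \<alpha>)"
          by (intro mult_right_mono card_dyadic_box_le) auto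
        finally show ?case by (simp add: mult.assoc)
      qed
    qed
  qed (simp add: emeasure_eq_measure)
  then show ?thesis
    by (rule AE_mp) (auto simp: E_def not_less elim!: eventually_mono)
qed

text \<open>
  Independence of all sites involved, together with \<open>1 - p \<le> exp (- p)\<close>.
\<close>

lemma prob_corners_below_le:
  assumes "finite J" "\<And>j. j \<in> J \<Longrightarrow> 1 \<le> a j"
  shows "prob {\<omega> \<in> space M. \<forall>j\<in>J. \<forall>z\<in>dyadic_corner j. \<xi> z \<omega> \<le> a j}
     \<le> exp (- (\<Sum>j\<in>J. (2 ^ j) ^ CARD('d) * a j powr (- \<alpha>)))"
proof -
  define S where "S = (\<Union>j\<in>J. dyadic_corner j :: (int ^ 'd) set)"
  define f where "f = (\<lambda>z :: int ^ 'd. a (THE j. z \<in> dyadic_corner j))"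
  have the: "(THE j. z \<in> dyadic_corner j) = j" if "z \<in> dyadic_corner j" for z :: "int ^ 'd" and j
  proof (rule the_equality[where P = "\<lambda>j. z \<in> dyadic_corner j", OF that])
    fix k assume k: "z \<in> dyadic_corner k"
    show "k = j"
    proof (rule ccontr)
      assume "k \<noteq> j"
      then have "dyadic_corner k \<inter> dyadic_corner j = ({} :: (int ^ 'd) set)"
        by (rule dyadic_corner_disjoint)
      then show False using k that by blast
    qed
  qed
  have f: "f z = a j" if "z \<in> dyadic_corner j" for z j
    using the[OF that] by (simp add: f_def)
  have "prob {\<omega> \<in> space M. \<forall>z\<in>S. \<xi> z \<omega> \<le> f z} \<le> exp (- (\<Sum>z\<in>S. f z powr (- \<alpha>)))"
    using assms f by (intro prob_none_exceeds_le) (auto simp: S_def finite_dyadic_corner)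
  moreover have "(\<Sum>z\<in>S. f z powr (- \<alpha>)) = (\<Sum>j\<in>J. \<Sum>z\<in>dyadic_corner j. f z powr (- \<alpha>))"
    unfolding S_def using assms(1) dyadic_corner_disjoint by (intro sum.UNION_disjoint) (auto simp: finite_dyadic_corner)
  moreover have "(\<Sum>z\<in>dyadic_corner j. f z powr (- \<alpha>)) = (2 ^ j) ^ CARD('d) * a j powr (- \<alpha>)" for j
    using card_dyadic_corner[of j, where 'd = 'd] by (simp add: f)
  moreover have "{\<omega> \<in> space M. \<forall>z\<in>S. \<xi> z \<omega> \<le> f z} = {\<omega> \<in> space M. \<forall>j\<in>J. \<forall>z\<in>dyadic_corner j. \<xi> z \<omega> \<le> a j}"
    by (auto simp: S_def f)
  ultimately show ?thesis by simp
qed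

lemma corner_below_measurable [measurable]:
  "{\<omega> \<in> space M. \<forall>z\<in>dyadic_corner j. \<xi> z \<omega> \<le> x} \<in> sets M"
  by measurable

text \<open>
  The convergent half of the Borel-Cantelli lemma for the events that a whole corner stays low.
\<close>

lemma AE_eventually_exceeds:
  assumes a: "\<forall>\<^sub>F j in sequentially. 1 \<le> a j"
    and sum: "summable (\<lambda>j. exp (- ((2 ^ j) ^ CARD('d) * a j powr (- \<alpha>))))"
  shows "AE \<omega> in M. \<forall>\<^sub>F j in sequentially. \<exists>z\<in>dyadic_corner j. a j < \<xi> z \<omega>"
proof -
  define E where "E = (\<lambda>j. {\<omega> \<in> space M. \<forall>z\<in>dyadic_corner j. \<xi> z \<omega> \<le> a j})"
  have "AE \<omega> in M. \<forall>\<^sub>F j in sequentially. \<omega> \<in> space M - E j"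
  proof (rule borel_cantelli_AE1)
    show "summable (\<lambda>j. prob (E j))"
    proof (rule summable_comparison_test_ev[OF _ sum])
      show "\<forall>\<^sub>F j in sequentially. norm (prob (E j)) \<le> exp (- ((2 ^ j) ^ CARD('d) * a j powr (- \<alpha>)))"
        using a
      proof eventually_elim
        case (elim j)
        then show ?case using prob_corners_below_le[of "{j}" a] by (simp add: E_def)
      qed
    qed
  qed (simp_all add: emeasure_eq_measure E_def corner_below_measurable)
  then show ?thesis
    by (rule AE_mp) (auto simp: E_def not_le elim!: eventually_mono)
qed

text \<open>
  The divergent half of the Borel-Cantelli lemma: the probability that all corners from some scale on
  stay low is at most \<open>exp\<close> of minus the tail of a divergent series.
\<close>

lemma AE_frequently_exceeds:
  assumes a: "\<forall>\<^sub>F j in sequentially. 1 \<le> a j"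
    and sum: "\<not> summable (\<lambda>j. (2 ^ j) ^ CARD('d) * a j powr (- \<alpha>))"
  shows "AE \<omega> in M. \<exists>\<^sub>F j in sequentially. \<exists>z\<in>dyadic_corner j. a j < \<xi> z \<omega>"
proof -
  obtain N where N: "\<And>j. N \<le> j \<Longrightarrow> 1 \<le> a j"
    using a by (auto simp: eventually_sequentially)
  define p where "p = (\<lambda>j. (2 ^ j) ^ CARD('d) * a j powr (- \<alpha>))"
  define E where "E = (\<lambda>m. {\<omega> \<in> space M. \<forall>j\<ge>m. \<forall>z\<in>dyadic_corner j. \<xi> z \<omega> \<le> a j})"
  have meas: "E m \<in> sets M" for m
    unfolding E_def by measurable
  have null: "prob (E m) = 0" if m: "N \<le> m" for m
  proof (rule ccontr)
    assume "prob (E m) \<noteq> 0"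
    then have pos: "0 < prob (E m)" using measure_nonneg[of M "E m"] by linarith
    have bound: "(\<Sum>j\<in>{m..<n}. p j) \<le> - ln (prob (E m))" for n
    proof -
      have "prob (E m) \<le> prob {\<omega> \<in> space M. \<forall>j\<in>{m..<n}. \<forall>z\<in>dyadic_corner j. \<xi> z \<omega> \<le> a j}"
        by (rule finite_measure_mono) (auto simp: E_def)
      also have "\<dots> \<le> exp (- (\<Sum>j\<in>{m..<n}. p j))"
        unfolding p_def using m N by (intro prob_corners_below_le) auto
      finally have "ln (prob (E m)) \<le> ln (exp (- (\<Sum>j\<in>{m..<n}. p j)))"
        using pos by (subst ln_le_cancel_iff) auto
      then show ?thesis by simp
    qed
    have "summable (\<lambda>j. p (j + m))"
    proof (rule summableI_nonneg_bounded)
      show "(\<Sum>j<n. p (j + m)) \<le> - ln (prob (E m))" for n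
        using bound[of "n + m"] sum.shift_bounds_nat_ivl[of p 0 m n]
        by (simp add: atLeast0LessThan)
    qed (simp add: p_def)
    then have "summable p" by (simp add: summable_iff_shift)
    then show False using sum by (simp add: p_def)
  qed
  have "AE \<omega> in M. \<forall>m. N \<le> m \<longrightarrow> \<omega> \<notin> E m"
    unfolding AE_all_countable
  proof
    fix m show "AE \<omega> in M. N \<le> m \<longrightarrow> \<omega> \<notin> E m"
      using null[of m] meas[of m]
      by (cases "N \<le> m") (auto intro!: AE_not_in simp: null_sets_def emeasure_eq_measure)
  qed
  then show ?thesis
  proof (rule AE_mp, intro AE_I2 impI)
    fix \<omega> assume \<omega>: "\<omega> \<in> space M" and *: "\<forall>m. N \<le> m \<longrightarrow> \<omega> \<notin> E m"
    show "\<exists>\<^sub>F j in sequentially. \<exists>z\<in>dyadic_corner j. a j < \<xi> z \<omega>"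
      unfolding frequently_sequentially
    proof
      fix m
      have "\<omega> \<notin> E (max m N)" using * by simp
      then obtain j z where "max m N \<le> j" "z \<in> dyadic_corner j" "\<not> \<xi> z \<omega> \<le> a j"
        using \<omega> by (auto simp: E_def)
      then show "\<exists>n\<ge>m. \<exists>z\<in>dyadic_corner n. a n < \<xi> z \<omega>"
        by (intro exI[of _ j]) (auto simp: not_le)
    qed
  qed
qed

text \<open>
  The union bound over the dyadic shells outside the box of scale \<open>j\<close> is a geometric series, since
  the number of sites grows like \<open>2 ^ (d * i)\<close> while the probability decays like
  \<open>2 powr (- \<alpha> * i)\<close>. Hence the cone costs no more than the box itself, up to a constant factor.
\<close>

lemma prob_above_cone_le:
  "\<exists>C. \<forall>j v. 1 \<le> v \<longrightarrow>
     prob {\<omega> \<in> space M. \<exists>z. v + v / 2 ^ j * norm1 z < \<xi> z \<omega>} \<le> C * ((2 ^ j) ^ CARD('d) * v powr (- \<alpha>))"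
proof -
  let ?d = "CARD('d)"
  define r where "r = 2 ^ ?d * 2 powr (- \<alpha>)"
  have "r = 2 powr (?d - \<alpha>)" by (simp add: r_def powr_diff powr_minus powr_realpow field_simps)
  also have "\<dots> < 2 powr 0" using alpha by (intro powr_less_mono) auto
  finally have r: "0 \<le> r" "r < 1" by (auto simp: r_def)
  define C where "C = 3 ^ ?d * (1 + 2 ^ ?d / (1 - r))"
  have "prob {\<omega> \<in> space M. \<exists>z. v + v / 2 ^ j * norm1 z < \<xi> z \<omega>} \<le> C * ((2 ^ j) ^ ?d * v powr (- \<alpha>))"
    if v: "1 \<le> v" for j v
  proof -
    define p where "p = (2 ^ j) ^ ?d * v powr (- \<alpha>)"
    define E where "E = (\<lambda>k x. {\<omega> \<in> space M. \<exists>z\<in>dyadic_box k. x < \<xi> z \<omega>})"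
    have meas: "E k x \<in> sets M" for k x
    proof -
      have "E k x = (\<Union>z\<in>dyadic_box k. {\<omega> \<in> space M. x < \<xi> z \<omega>})" by (auto simp: E_def)
      also have "\<dots> \<in> sets M" by (intro sets.finite_UN finite_dyadic_box) measurable
      finally show ?thesis .
    qed
    have probE: "prob (E k x) \<le> 3 ^ ?d * (2 ^ k) ^ ?d * x powr (- \<alpha>)" if "1 \<le> x" for k x
    proof -
      have "prob (E k x) \<le> card (dyadic_box k :: (int ^ 'd) set) * x powr (- \<alpha>)"
        unfolding E_def by (rule prob_some_exceeds_le[OF finite_dyadic_box that])
      also have "\<dots> \<le> 3 ^ ?d * (2 ^ k) ^ ?d * x powr (- \<alpha>)"
        by (intro mult_right_mono card_dyadic_box_le) auto
      finally show ?thesis .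
    qed
    have shell: "prob (E (Suc (j + i)) (v * 2 ^ i)) \<le> 3 ^ ?d * 2 ^ ?d * p * r ^ i" for i
    proof -
      have "1 * 1 \<le> v * 2 ^ i" using v by (intro mult_mono) auto
      then have "prob (E (Suc (j + i)) (v * 2 ^ i)) \<le> 3 ^ ?d * (2 ^ Suc (j + i)) ^ ?d * (v * 2 ^ i) powr (- \<alpha>)"
        by (intro probE) simp
      also have "(v * 2 ^ i) powr (- \<alpha>) = v powr (- \<alpha>) * (2 powr (- \<alpha>)) ^ i"
        using v by (simp add: powr_mult powr_realpow[symmetric] powr_powr mult.commute)
      also have "3 ^ ?d * (2 ^ Suc (j + i)) ^ ?d * (v powr (- \<alpha>) * (2 powr (- \<alpha>)) ^ i) = 3 ^ ?d * 2 ^ ?d * p * r ^ i"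
        by (simp add: p_def r_def power_add power_mult_distrib power_mult[symmetric] mult_ac)
      finally show ?thesis .
    qed
    have sums: "(\<lambda>i. 3 ^ ?d * 2 ^ ?d * p * r ^ i) sums (3 ^ ?d * 2 ^ ?d * p * (1 / (1 - r)))"
      using r by (intro sums_mult geometric_sums) auto
    have summ: "summable (\<lambda>i. prob (E (Suc (j + i)) (v * 2 ^ i)))"
      by (rule summable_comparison_test'[OF sums_summable[OF sums]]) (use shell in auto)
    have "{\<omega> \<in> space M. \<exists>z. v + v / 2 ^ j * norm1 z < \<xi> z \<omega>} \<subseteq> E j v \<union> (\<Union>i. E (Suc (j + i)) (v * 2 ^ i))"
    proof
      fix \<omega> assume "\<omega> \<in> {\<omega> \<in> space M. \<exists>z. v + v / 2 ^ j * norm1 z < \<xi> z \<omega>}"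
      then obtain z where \<omega>: "\<omega> \<in> space M" and z: "v + v / 2 ^ j * norm1 z < \<xi> z \<omega>" by auto
      show "\<omega> \<in> E j v \<union> (\<Union>i. E (Suc (j + i)) (v * 2 ^ i))"
      proof (cases "z \<in> dyadic_box j")
        case True
        have "0 \<le> v / 2 ^ j * norm1 z" using v by simp
        then show ?thesis using True \<omega> z by (auto simp: E_def intro!: bexI[of _ z])
      next
        case False
        then obtain k where k: "j \<le> k" "z \<notin> dyadic_box k" "z \<in> dyadic_box (Suc k)" by (rule dyadic_shell)
        then obtain i where i: "k = j + i" by (auto simp: le_iff_add)
        have "v * 2 ^ i = v / 2 ^ j * 2 ^ k" by (simp add: i power_add)
        also have "\<dots> \<le> v / 2 ^ j * norm1 z"
          using norm1_not_in_dyadic_box[OF k(2)] v by (intro mult_left_mono) auto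
        finally have "v * 2 ^ i < \<xi> z \<omega>" using z v by linarith
        then have "\<omega> \<in> E (Suc (j + i)) (v * 2 ^ i)" using \<omega> k i by (auto simp: E_def)
        then show ?thesis by blast
      qed
    qed
    then have "prob {\<omega> \<in> space M. \<exists>z. v + v / 2 ^ j * norm1 z < \<xi> z \<omega>} \<le> prob (E j v \<union> (\<Union>i. E (Suc (j + i)) (v * 2 ^ i)))"
      using meas by (intro finite_measure_mono) auto
    also have "\<dots> \<le> prob (E j v) + prob (\<Union>i. E (Suc (j + i)) (v * 2 ^ i))"
      using meas by (intro measure_Un_le) auto
    also have "prob (\<Union>i. E (Suc (j + i)) (v * 2 ^ i)) \<le> (\<Sum>i. prob (E (Suc (j + i)) (v * 2 ^ i)))"
      using meas summ by (intro finite_measure_subadditive_countably) auto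
    also have "\<dots> \<le> (\<Sum>i. 3 ^ ?d * 2 ^ ?d * p * r ^ i)"
      by (intro suminf_le shell summ sums_summable[OF sums])
    also have "\<dots> = 3 ^ ?d * 2 ^ ?d * p * (1 / (1 - r))" using sums by (simp add: sums_iff)
    also have "prob (E j v) \<le> 3 ^ ?d * p" using probE[OF v, of j] by (simp add: p_def mult.assoc)
    also have "3 ^ ?d * p + 3 ^ ?d * 2 ^ ?d * p * (1 / (1 - r)) = C * p"
      by (simp add: C_def algebra_simps)
    finally show ?thesis by (simp add: p_def)
  qed
  then show ?thesis by blast
qed

text \<open>
  The exceptional events have probabilities that tend to zero, so the probability that all of them
  occur from some scale on is zero.
\<close>

lemma AE_frequently_below_cone:
  assumes a: "\<forall>\<^sub>F j in sequentially. 1 \<le> a j"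
    and lim: "(\<lambda>j. (2 ^ j) ^ CARD('d) * a j powr (- \<alpha>)) \<longlonglongrightarrow> 0"
  shows "AE \<omega> in M. \<exists>\<^sub>F j in sequentially. \<forall>z. \<xi> z \<omega> \<le> a j + a j / 2 ^ j * norm1 z"
proof -
  obtain C where C: "\<And>j v. 1 \<le> v \<Longrightarrow>
     prob {\<omega> \<in> space M. \<exists>z. v + v / 2 ^ j * norm1 z < \<xi> z \<omega>} \<le> C * ((2 ^ j) ^ CARD('d) * v powr (- \<alpha>))"
    using prob_above_cone_le by blast
  define B where "B = (\<lambda>j. {\<omega> \<in> space M. \<exists>z. a j + a j / 2 ^ j * norm1 z < \<xi> z \<omega>})"
  define E where "E = (\<lambda>m. {\<omega> \<in> space M. \<forall>j\<ge>m. \<exists>z. a j + a j / 2 ^ j * norm1 z < \<xi> z \<omega>})"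
  have meas: "E m \<in> sets M" "B m \<in> sets M" for m
    unfolding E_def B_def by measurable
  have lim0: "(\<lambda>j. prob (B j)) \<longlonglongrightarrow> 0"
  proof (rule tendsto_sandwich[where f = "\<lambda>_. 0"])
    show "(\<lambda>j. C * ((2 ^ j) ^ CARD('d) * a j powr (- \<alpha>))) \<longlonglongrightarrow> 0"
      using tendsto_mult[OF tendsto_const lim, of C] by simp
    show "\<forall>\<^sub>F j in sequentially. prob (B j) \<le> C * ((2 ^ j) ^ CARD('d) * a j powr (- \<alpha>))"
      using a unfolding B_def by eventually_elim (rule C)
  qed auto
  have null: "prob (E m) = 0" for m
  proof -
    have "prob (E m) \<le> prob (B j)" if "m \<le> j" for j
      using that meas by (intro finite_measure_mono) (auto simp: E_def B_def)
    then have "prob (E m) \<le> 0"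
      by (intro LIMSEQ_le_const[OF lim0]) blast
    then show ?thesis using measure_nonneg[of M "E m"] by linarith
  qed
  have "AE \<omega> in M. \<forall>m. \<omega> \<notin> E m"
    unfolding AE_all_countable
    using null meas by (auto intro!: AE_not_in simp: null_sets_def emeasure_eq_measure)
  then show ?thesis
    by (rule AE_mp) (auto intro!: AE_I2 simp: E_def frequently_sequentially not_less)
qed

end

section \<open>From extremes of the potential to the growth rate\<close>

text \<open>
  All sizes of the potential that occur are of this form, as functions of the distance.
\<close>

definition log_scale :: "real \<Rightarrow> real \<Rightarrow> real \<Rightarrow> real \<Rightarrow> real" where
  "log_scale b k m x = x powr b * ln x powr k * ln (ln x) powr m"

lemma eventually_ln_ln_pos: "\<forall>\<^sub>F x::real in at_top. 0 < x \<and> 0 < ln x \<and> 0 < ln (ln x)"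
  by (intro eventually_conj; real_asymp)

lemma log_scale_pos: "0 < x \<Longrightarrow> 0 < ln x \<Longrightarrow> 0 < ln (ln x) \<Longrightarrow> 0 < log_scale b k m x"
  by (simp add: log_scale_def)

lemma ln_log_scale:
  assumes "0 < x" "0 < ln x" "0 < ln (ln x)"
  shows "ln (log_scale b k m x) = b * ln x + k * ln (ln x) + m * ln (ln (ln x))"
  using assms by (simp add: log_scale_def ln_mult ln_powr)

text \<open>
  In the variable \<open>y = ln x\<close>, the logarithm of the scale is \<open>b * y + k * ln y + m * ln (ln y)\<close>,
  with derivative tending to \<open>b\<close>.
\<close>

lemma log_scale_eventually_mono:
  assumes "0 < b"
  obtains x0 where "\<And>x y. x0 \<le> x \<Longrightarrow> x \<le> y \<Longrightarrow> log_scale b k m x \<le> log_scale b k m y"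
proof -
  have "((\<lambda>y::real. b + k / y + m / (y * ln y)) \<longlongrightarrow> b) at_top" by real_asymp
  then have "\<forall>\<^sub>F y in at_top. 0 < b + k / y + m / (y * ln y)"
    using assms by (rule order_tendstoD(1))
  then have "\<forall>\<^sub>F y::real in at_top. 0 < b + k / y + m / (y * ln y) \<and> 1 < y"
    by (intro eventually_conj eventually_gt_at_top)
  then obtain y0 where y0: "\<And>y. y0 \<le> y \<Longrightarrow> 0 < b + k / y + m / (y * ln y) \<and> 1 < y"
    unfolding eventually_at_top_linorder by blast
  show thesis
  proof (rule that[of "exp y0"])
    fix x y :: real assume xy: "exp y0 \<le> x" "x \<le> y"
    have pos: "0 < x" "0 < y" using less_le_trans[OF exp_gt_zero xy(1)] xy(2) by auto
    have lxy: "y0 \<le> ln x" "ln x \<le> ln y" using xy pos by (auto simp: ln_ge_iff)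
    define \<phi> where "\<phi> = (\<lambda>y. b * y + k * ln y + m * ln (ln y))"
    have "\<phi> (ln x) \<le> \<phi> (ln y)"
    proof (rule DERIV_nonneg_imp_nondecreasing[OF lxy(2)])
      fix u assume u: "ln x \<le> u"
      then have u1: "1 < u" "0 < b + k / u + m / (u * ln u)" using y0[of u] lxy by auto
      have "(\<phi> has_real_derivative b + k / u + m / (u * ln u)) (at u)"
        unfolding \<phi>_def using u1 by (auto intro!: derivative_eq_intros simp: field_simps)
      then show "\<exists>y. (\<phi> has_real_derivative y) (at u) \<and> 0 \<le> y"
        using u1 by (intro exI conjI) auto
    qed
    moreover have eq: "log_scale b k m v = exp (\<phi> (ln v))" if "0 < v" "1 < ln v" for v
    proof -
      have "v \<noteq> 1" "0 < ln (ln v)" using that(2) ln_gt_zero[OF that(2)] by auto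
      then show ?thesis using that by (simp add: \<phi>_def log_scale_def powr_def exp_add)
    qed
    ultimately show "log_scale b k m x \<le> log_scale b k m y"
      using eq[of x] eq[of y] pos y0[of "ln x"] y0[of "ln y"] lxy by (metis exp_le_cancel_iff order_trans)
  qed
qed

text \<open>
  The time \<open>t\<close> at which going to distance \<open>x\<close>, at cost of order \<open>x * ln x / t\<close> in the growth rate,
  is balanced by a peak of size \<open>F x\<close> there. Time is parametrised by distance, rather than the reverse, because this
  relation is explicit.
\<close>

definition scale_time :: "real \<Rightarrow> (real \<Rightarrow> real) \<Rightarrow> real \<Rightarrow> real" where
  "scale_time K F x = K * (x * ln x / F x)"

text \<open>
  What holds along the parametrisation holds at all large times, by the intermediate value theorem.
\<close>

lemma eventually_at_top_range:
  fixes \<tau> :: "real \<Rightarrow> real"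
  assumes lim: "filterlim \<tau> at_top at_top" and cont: "continuous_on {x0..} \<tau>"
    and P: "\<forall>\<^sub>F x in at_top. P (\<tau> x)"
  shows "\<forall>\<^sub>F t in at_top. P t"
proof -
  obtain x1 where x1: "x0 \<le> x1" "\<And>x. x1 \<le> x \<Longrightarrow> P (\<tau> x)"
    using P unfolding eventually_at_top_linorder by (metis dual_order.trans linorder_linear)
  have "P t" if t: "\<tau> x1 \<le> t" for t
  proof -
    have "\<forall>\<^sub>F x in at_top. t \<le> \<tau> x \<and> x1 \<le> x"
      using lim by (intro eventually_conj eventually_ge_at_top) (simp add: filterlim_at_top)
    then obtain x2 where x2: "t \<le> \<tau> x2" "x1 \<le> x2"
      using eventually_happens'[OF trivial_limit_at_top_linorder] by blast
    have "continuous_on {x1..x2} \<tau>" using x1(1) by (intro continuous_on_subset[OF cont]) auto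
    then obtain x where "x1 \<le> x" "\<tau> x = t"
      using IVT'[of \<tau> x1 t x2] t x2 by blast
    then show "P t" using x1(2) by blast
  qed
  then show ?thesis unfolding eventually_at_top_linorder by blast
qed

context
  fixes F :: "real \<Rightarrow> real" and \<beta> \<kappa> \<mu> :: real
  assumes F_def: "F = log_scale \<beta> \<kappa> \<mu>" and \<beta>: "0 < \<beta>" "\<beta> < 1"
begin

lemma scale_pos: "0 < x \<Longrightarrow> 0 < ln x \<Longrightarrow> 0 < ln (ln x) \<Longrightarrow> 0 < F x"
  unfolding F_def by (rule log_scale_pos)

lemma filterlim_scale_time:
  assumes "0 < K"
  shows "filterlim (scale_time K F) at_top at_top"
proof -
  have "filterlim (\<lambda>x. K * (x * ln x / (x powr \<beta> * ln x powr \<kappa> * ln (ln x) powr \<mu>))) at_top at_top"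
    using assms \<beta> by real_asymp
  then show ?thesis by (simp add: scale_time_def[abs_def] F_def log_scale_def)
qed

lemma continuous_on_scale_time: "continuous_on {exp (exp 1)..} (scale_time K F)"
proof -
  have "x \<noteq> 0 \<and> ln x \<noteq> 0 \<and> ln (ln x) \<noteq> 0 \<and> 0 \<le> ln x \<and> 0 \<le> ln (ln x)" if "exp (exp 1) \<le> x" for x :: real
  proof -
    have x: "0 < x" using that by (meson exp_gt_zero less_le_trans)
    then have "exp 1 \<le> ln x" using that by (simp add: ln_ge_iff)
    moreover from this have "0 < ln x" by (meson exp_gt_zero less_le_trans)
    moreover from calculation have "1 \<le> ln (ln x)" using ln_ge_iff[of "ln x" 1] by simp
    ultimately show ?thesis using x by linarith
  qed
  then show ?thesis
    unfolding scale_time_def F_def log_scale_def by (auto intro!: continuous_intros)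
qed

lemma filterlim_log_scale: "filterlim F at_top at_top"
proof -
  have "filterlim (\<lambda>x. x powr \<beta> * ln x powr \<kappa> * ln (ln x) powr \<mu>) at_top at_top"
    using \<beta> by real_asymp
  then show ?thesis by (simp add: F_def log_scale_def[abs_def])
qed

lemma log_scale_half: "\<forall>\<^sub>F x in at_top. F x / 4 \<le> F (x / 2)"
proof -
  have "((\<lambda>x. (x / 2) powr \<beta> * ln (x / 2) powr \<kappa> * ln (ln (x / 2)) powr \<mu> / (x powr \<beta> * ln x powr \<kappa> * ln (ln x) powr \<mu>)) \<longlongrightarrow> (1 / 2) powr \<beta>) at_top"
    using \<beta> by real_asymp
  moreover have "(1 / 2 :: real) powr 1 < (1 / 2) powr \<beta>" using \<beta> by (intro powr_less_mono') auto
  ultimately have "\<forall>\<^sub>F x in at_top. 1 / 4 < F (x / 2) / F x"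
    unfolding F_def log_scale_def by (intro order_tendstoD(1)) auto
  with eventually_ln_ln_pos show ?thesis
    by eventually_elim (auto simp: scale_pos less_divide_eq)
qed

lemma log_scale_double: "\<forall>\<^sub>F x in at_top. F (2 * x) \<le> 2 * F x"
proof -
  have "((\<lambda>x. (2 * x) powr \<beta> * ln (2 * x) powr \<kappa> * ln (ln (2 * x)) powr \<mu> / (x powr \<beta> * ln x powr \<kappa> * ln (ln x) powr \<mu>)) \<longlongrightarrow> 2 powr \<beta>) at_top"
    using \<beta> by real_asymp
  moreover have "(2 :: real) powr \<beta> < 2 powr 1" using \<beta> by (intro powr_less_mono) auto
  ultimately have "\<forall>\<^sub>F x in at_top. F (2 * x) / F x < 2"
    unfolding F_def log_scale_def by (intro order_tendstoD(2)) auto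
  with eventually_ln_ln_pos show ?thesis
    by eventually_elim (auto simp: scale_pos divide_less_eq)
qed

text \<open>
  The exponent of \<open>F x / x\<close> is \<open>\<beta> - 1 < 0\<close>, so its reciprocal is again an eventually increasing
  scale.
\<close>

lemma log_scale_cone:
  obtains x0 where "0 < x0" "\<And>x y. x0 \<le> x \<Longrightarrow> x \<le> y \<Longrightarrow> F x \<le> F y"
    "\<And>x y. x0 \<le> x \<Longrightarrow> x \<le> y \<Longrightarrow> F y / y \<le> F x / x"
proof -
  obtain x1 where x1: "\<And>x y. x1 \<le> x \<Longrightarrow> x \<le> y \<Longrightarrow> F x \<le> F y"
    using log_scale_eventually_mono[OF \<beta>(1)] unfolding F_def by blast
  obtain x2 where x2: "\<And>x y. x2 \<le> x \<Longrightarrow> x \<le> y \<Longrightarrow> log_scale (1 - \<beta>) (- \<kappa>) (- \<mu>) x \<le> log_scale (1 - \<beta>) (- \<kappa>) (- \<mu>) y"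
    using log_scale_eventually_mono[of "1 - \<beta>"] \<beta>(2) by (metis diff_gt_0_iff_gt)
  obtain x3 :: real where x3: "\<forall>x\<ge>x3. 0 < x \<and> 0 < ln x \<and> 0 < ln (ln x)"
    using eventually_ln_ln_pos unfolding eventually_at_top_linorder by blast
  have inv: "F x / x = inverse (log_scale (1 - \<beta>) (- \<kappa>) (- \<mu>) x)" if "0 < x" for x
    using that by (simp add: F_def log_scale_def powr_diff powr_minus field_simps)
  show thesis
  proof (rule that[of "max 1 (max x1 (max x2 x3))"])
    fix x y assume xy: "max 1 (max x1 (max x2 x3)) \<le> x" "x \<le> y"
    show "F x \<le> F y" using x1 xy by simp
    show "F y / y \<le> F x / x"
      using x2[of x y] x3 xy inv[of x] inv[of y]
      by (auto intro!: le_imp_inverse_le log_scale_pos)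
  qed simp
qed

text \<open>
  Up to distance \<open>x\<close>, the level of the next dyadic box is at most \<open>F (2 * x)\<close>. Beyond it, the level
  grows at most with slope \<open>F (2 * x) / x\<close>, because \<open>F y / y\<close> is decreasing. The factor \<open>2\<close>
  comes from passing from one dyadic box to the next.
\<close>

lemma envelope_cone:
  fixes V :: "int ^ 'd::finite \<Rightarrow> real"
  assumes env: "\<forall>\<^sub>F j in sequentially. \<forall>z\<in>dyadic_box j. V z \<le> F (2 ^ j)"
  shows "\<forall>\<^sub>F x in at_top. \<forall>z. V z \<le> F (2 * x) + F (2 * x) / x * norm1 z"
proof -
  obtain x0 where x0: "0 < x0" "\<And>x y. x0 \<le> x \<Longrightarrow> x \<le> y \<Longrightarrow> F x \<le> F y"
    "\<And>x y. x0 \<le> x \<Longrightarrow> x \<le> y \<Longrightarrow> F y / y \<le> F x / x"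
    by (rule log_scale_cone) blast
  have "\<forall>\<^sub>F j in sequentially. x0 \<le> (2 :: real) ^ j" by real_asymp
  from eventually_conj[OF this env]
  obtain J where J: "\<And>j. J \<le> j \<Longrightarrow> x0 \<le> 2 ^ j" "\<And>j z. J \<le> j \<Longrightarrow> z \<in> dyadic_box j \<Longrightarrow> V z \<le> F (2 ^ j)"
    unfolding eventually_sequentially by blast
  have F0: "0 \<le> F x" for x by (simp add: F_def log_scale_def)
  have "\<forall>\<^sub>F x in at_top. (2 :: real) ^ J \<le> x" by (rule eventually_ge_at_top)
  then show ?thesis
  proof eventually_elim
    case (elim x)
    have x: "0 < x" "x0 \<le> x" using elim J(1)[of J] x0(1) by auto
    show ?case
    proof
      fix z
      show "V z \<le> F (2 * x) + F (2 * x) / x * norm1 z"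
      proof (cases "z \<in> dyadic_box J")
        case True
        then have "V z \<le> F (2 ^ J)" using J by blast
        also have "\<dots> \<le> F (2 * x)" using J(1)[of J] elim x by (intro x0(2)) auto
        also have "\<dots> \<le> F (2 * x) + F (2 * x) / x * norm1 z" using x F0[of "2 * x"] by simp
        finally show ?thesis .
      next
        case False
        then obtain j where j: "J \<le> j" "z \<notin> dyadic_box j" "z \<in> dyadic_box (Suc j)"
          by (rule dyadic_shell)
        have "V z \<le> F (2 * 2 ^ j)" using J(2)[of "Suc j" z] j by simp
        also have "\<dots> \<le> F (2 * x) + F (2 * x) / x * norm1 z"
        proof (cases "2 ^ j \<le> x")
          case True
          have "F (2 * 2 ^ j) \<le> F (2 * x)" using True J(1)[OF j(1)] x0(1) by (intro x0(2)) auto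
          then show ?thesis using x F0[of "2 * x"] by (simp add: add_increasing2)
        next
          case False
          have "F (2 * 2 ^ j) / (2 * 2 ^ j) \<le> F (2 * x) / (2 * x)"
            using False x by (intro x0(3)) auto
          then have "F (2 * 2 ^ j) \<le> F (2 * x) / x * 2 ^ j"
            using x by (simp add: field_simps)
          also have "\<dots> \<le> F (2 * x) / x * norm1 z"
            using norm1_not_in_dyadic_box[OF j(2)] x F0 by (intro mult_left_mono) auto
          finally show ?thesis using F0[of "2 * x"] by simp
        qed
        finally show ?thesis .
      qed
    qed
  qed
qed

lemma envelope_linear:
  fixes V :: "int ^ 'd::finite \<Rightarrow> real"
  assumes env: "\<forall>\<^sub>F j in sequentially. \<forall>z\<in>dyadic_box j. V z \<le> F (2 ^ j)"
  obtains A c :: real where "0 \<le> c" "\<And>z. V z \<le> A + c * norm1 z"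
proof -
  obtain x where x: "0 < x" "\<And>z. V z \<le> F (2 * x) + F (2 * x) / x * norm1 z"
    using eventually_happens'[OF trivial_limit_at_top_linorder eventually_conj[OF eventually_gt_at_top[of 0] envelope_cone[OF env]]]
    by blast
  show thesis
    by (rule that[of "F (2 * x) / x" "F (2 * x)"]) (use x in \<open>auto simp: F_def log_scale_def\<close>)
qed

text \<open>
  Upper bound on the growth rate from a cone above the potential. With \<open>h = 2 * F x / x\<close> the factor
  \<open>\<beta> / 4\<close> in the time makes \<open>exp (h * t) = x powr (\<beta> / 2)\<close>, which is negligible against
  \<open>F x\<close>.
\<close>

lemma cone_growth:
  fixes V :: "int ^ 'd::finite \<Rightarrow> real" and A c :: real
  assumes V: "\<And>z. 0 \<le> V z" "\<And>z. V z \<le> A + c * norm1 z" "0 \<le> c"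
  shows "\<forall>\<^sub>F x in at_top. (\<forall>z. V z \<le> 2 * F x + 2 * F x / x * norm1 z) \<longrightarrow>
     pam_growth_rate V (scale_time (\<beta> / 4) F x) \<le> 3 * F x"
proof -
  let ?D = "lattice_degree TYPE('d)"
  have "((\<lambda>x. ?D * x powr (\<beta> / 2) / (x powr \<beta> * ln x powr \<kappa> * ln (ln x) powr \<mu>)) \<longlongrightarrow> 0) at_top"
  proof -
    have "((\<lambda>x. x powr (\<beta> / 2) / (x powr \<beta> * ln x powr \<kappa> * ln (ln x) powr \<mu>)) \<longlongrightarrow> 0) at_top"
      using \<beta> by real_asymp
    from tendsto_mult[OF tendsto_const this, of ?D] show ?thesis by simp
  qed
  then have "\<forall>\<^sub>F x in at_top. ?D * x powr (\<beta> / 2) / F x < 1"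
    unfolding F_def log_scale_def by (rule order_tendstoD(2)) simp
  then show ?thesis using eventually_ln_ln_pos
  proof (eventually_elim, intro impI)
    fix x assume elim: "?D * x powr (\<beta> / 2) / F x < 1" "0 < x \<and> 0 < ln x \<and> 0 < ln (ln x)"
      and cone: "\<forall>z. V z \<le> 2 * F x + 2 * F x / x * norm1 z"
    have Fx: "0 < F x" using elim by (intro scale_pos) auto
    have t: "0 < scale_time (\<beta> / 4) F x" using elim Fx \<beta> by (simp add: scale_time_def)
    have "2 * F x / x * scale_time (\<beta> / 4) F x = \<beta> / 2 * ln x"
      using elim Fx by (simp add: scale_time_def field_simps)
    then have e: "exp (2 * F x / x * scale_time (\<beta> / 4) F x) = x powr (\<beta> / 2)"
      using elim by (simp add: powr_def)
    have "pam_growth_rate V (scale_time (\<beta> / 4) F x) \<le> 2 * F x + ?D * exp (2 * F x / x * scale_time (\<beta> / 4) F x)"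
      using elim Fx t cone by (intro pam_growth_rate_upper_bound[OF V] cone[rule_format]) auto
    also have "\<dots> \<le> 2 * F x + F x" unfolding e using elim(1) Fx by (simp add: divide_less_eq)
    finally show "pam_growth_rate V (scale_time (\<beta> / 4) F x) \<le> 3 * F x" by simp
  qed
qed

text \<open>
  Lower bound on the growth rate from a single peak. The factor \<open>64 * d\<close> in the time makes the cost
  of travelling at most \<open>F x / 16\<close>; half of the peak is at least \<open>F x / 8\<close>, and \<open>2d\<close> is eventually at
  most \<open>F x / 32\<close>.
\<close>

lemma peak_growth:
  fixes V :: "int ^ 'd::finite \<Rightarrow> real" and A c :: real
  assumes V: "\<And>z. 0 \<le> V z" "\<And>z. V z \<le> A + c * norm1 z" "0 \<le> c"
  shows "\<forall>\<^sub>F x :: real in at_top. \<forall>z. F (x / 2) \<le> V z \<longrightarrow> real (norm1 z) \<le> 2 * real CARD('d) * x \<longrightarrow>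
     F x / 32 \<le> pam_growth_rate V (scale_time (64 * real CARD('d)) F x)"
proof -
  let ?D = "lattice_degree TYPE('d)"
  define d where "d = real CARD('d)"
  have d: "1 \<le> d" by (simp add: d_def Suc_leI)
  have 1: "\<forall>\<^sub>F x in at_top. 2 * d * x * ln (2 * d * x) \<le> 4 * d * (x * ln x)"
    using d by real_asymp
  have 2: "\<forall>\<^sub>F x in at_top. 32 * ?D \<le> F x"
    using filterlim_log_scale by (simp add: filterlim_at_top)
  have 3: "\<forall>\<^sub>F x in at_top. 2 \<le> scale_time (64 * d) F x"
    using filterlim_scale_time[of "64 * d"] d by (simp add: filterlim_at_top)
  show ?thesis
    using 1 2 3 log_scale_half eventually_ln_ln_pos eventually_ge_at_top[of 1]
  proof (eventually_elim, intro allI impI)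
    fix x z assume a: "2 * d * x * ln (2 * d * x) \<le> 4 * d * (x * ln x)" "32 * ?D \<le> F x"
      "2 \<le> scale_time (64 * d) F x" "F x / 4 \<le> F (x / 2)" "0 < x \<and> 0 < ln x \<and> 0 < ln (ln x)" "1 \<le> x"
      and z: "F (x / 2) \<le> V z" "real (norm1 z) \<le> 2 * real CARD('d) * x"
    let ?t = "scale_time (64 * d) F x" and ?N = "2 * d * x"
    have Fx: "0 < F x" using a by (intro scale_pos) auto
    have zN: "real (norm1 z) \<le> ?N" using z(2) by (simp add: d_def)
    have N: "1 * 1 \<le> ?N" using d a by (intro mult_mono) auto
    have "norm1 z * ln (norm1 z) \<le> ?N * ln ?N"
    proof (cases "norm1 z = 0")
      case False
      then have "1 \<le> real (norm1 z)" by linarith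
      then show ?thesis using zN N by (intro mult_mono) auto
    qed (use N in simp)
    also have "\<dots> \<le> 4 * d * (x * ln x)" by (rule a)
    finally have "norm1 z * ln (norm1 z) / ?t \<le> 4 * d * (x * ln x) / ?t"
      using a by (intro divide_right_mono) auto
    also have "\<dots> = F x / 16"
      using a Fx d by (simp add: scale_time_def field_simps)
    finally have "norm1 z * ln (norm1 z) / ?t \<le> F x / 16" .
    moreover have "V z / 2 - ?D - norm1 z * ln (norm1 z) / ?t \<le> pam_growth_rate V ?t"
      by (rule pam_growth_rate_lower_bound[OF V a(3)])
    ultimately show "F x / 32 \<le> pam_growth_rate V (scale_time (64 * real CARD('d)) F x)"
      using a z unfolding d_def by linarith
  qed
qed

lemma peaks_growth_eventually:
  fixes V :: "int ^ 'd::finite \<Rightarrow> real" and A c :: real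
  assumes V: "\<And>z. 0 \<le> V z" "\<And>z. V z \<le> A + c * norm1 z" "0 \<le> c"
    and peaks: "\<forall>\<^sub>F j in sequentially. \<exists>z\<in>dyadic_corner j. F (2 ^ j) < V z"
  shows "\<forall>\<^sub>F x in at_top. F x / 32 \<le> pam_growth_rate V (scale_time (64 * real CARD('d)) F x)"
proof -
  obtain J where J: "\<And>j. J \<le> j \<Longrightarrow> \<exists>z\<in>dyadic_corner j. F (2 ^ j) < V z"
    using peaks unfolding eventually_sequentially by blast
  obtain x0 where x0: "0 < x0" "\<And>x y. x0 \<le> x \<Longrightarrow> x \<le> y \<Longrightarrow> F x \<le> F y"
    by (rule log_scale_cone) blast
  show ?thesis
    using peak_growth[OF V] eventually_ge_at_top[of "2 * x0"] eventually_ge_at_top[of "2 ^ J"]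
      eventually_ge_at_top[of 1]
  proof eventually_elim
    case (elim x)
    \<comment> \<open>the dyadic scale with \<open>x / 2 < 2 ^ j \<le> x\<close>\<close>
    define j where "j = nat \<lfloor>log 2 x\<rfloor>"
    have log: "0 \<le> log 2 x" using elim by simp
    have "2 ^ j = (2 :: real) powr (of_int \<lfloor>log 2 x\<rfloor>)"
      using log by (simp add: j_def powr_realpow[symmetric])
    also have "\<dots> \<le> 2 powr (log 2 x)" by (intro powr_mono) auto
    finally have jx: "2 ^ j \<le> x" using elim by simp
    have "2 powr (log 2 x) < (2 :: real) powr (of_int \<lfloor>log 2 x\<rfloor> + 1)" by (intro powr_less_mono) linarith+
    also have "\<dots> = 2 * 2 ^ j"
      using log by (simp add: j_def powr_realpow[symmetric] powr_add)
    finally have xj: "x < 2 * 2 ^ j" using elim by simp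
    have "real J = log 2 (2 ^ J)" by (simp add: log_nat_power)
    also have "\<dots> \<le> log 2 x" using elim by (subst log_le_cancel_iff) auto
    finally have "J \<le> j" unfolding j_def using log by (simp add: le_nat_iff le_floor_iff)
    then obtain z where z: "z \<in> dyadic_corner j" "F (2 ^ j) < V z" using J by blast
    have "F (x / 2) \<le> F (2 ^ j)" using elim xj by (intro x0(2)) auto
    moreover have "real (norm1 z) \<le> 2 * real CARD('d) * x"
    proof -
      have "real (norm1 z) \<le> real (CARD('d) * 2 ^ Suc j)"
        using norm1_dyadic_corner[OF z(1)] by (rule of_nat_mono)
      also have "\<dots> = 2 * real CARD('d) * 2 ^ j" by simp
      also have "\<dots> \<le> 2 * real CARD('d) * x" using jx by (intro mult_left_mono) auto
      finally show ?thesis .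
    qed
    ultimately show ?case using elim(1) z(2) by (meson less_imp_le order_trans)
  qed
qed

lemma peaks_growth_frequently:
  fixes V :: "int ^ 'd::finite \<Rightarrow> real" and A c :: real
  assumes V: "\<And>z. 0 \<le> V z" "\<And>z. V z \<le> A + c * norm1 z" "0 \<le> c"
    and peaks: "\<exists>\<^sub>F j in sequentially. \<exists>z\<in>dyadic_corner j. F (2 ^ j) < V z"
  shows "\<exists>\<^sub>F j in sequentially. F (2 ^ j) / 32 \<le> pam_growth_rate V (scale_time (64 * real CARD('d)) F (2 ^ j))"
proof -
  obtain x0 where x0: "0 < x0" "\<And>x y. x0 \<le> x \<Longrightarrow> x \<le> y \<Longrightarrow> F x \<le> F y"
    by (rule log_scale_cone) blast
  have lim: "filterlim (\<lambda>j. (2 :: real) ^ j) at_top sequentially" by real_asymp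
  have "\<forall>\<^sub>F j in sequentially. \<forall>z. F (2 ^ j / 2) \<le> V z \<longrightarrow> real (norm1 z) \<le> 2 * real CARD('d) * 2 ^ j \<longrightarrow>
     F (2 ^ j) / 32 \<le> pam_growth_rate V (scale_time (64 * real CARD('d)) F (2 ^ j))"
    using eventually_compose_filterlim[OF peak_growth[OF V] lim] by simp
  moreover have "\<forall>\<^sub>F j in sequentially. 2 * x0 \<le> 2 ^ j"
    using lim by (simp add: filterlim_at_top)
  ultimately have "\<forall>\<^sub>F j in sequentially. (\<exists>z\<in>dyadic_corner j. F (2 ^ j) < V z) \<longrightarrow>
     F (2 ^ j) / 32 \<le> pam_growth_rate V (scale_time (64 * real CARD('d)) F (2 ^ j))"
  proof eventually_elim
    case (elim j)
    show ?case
    proof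
      assume "\<exists>z\<in>dyadic_corner j. F (2 ^ j) < V z"
      then obtain z where z: "z \<in> dyadic_corner j" "F (2 ^ j) < V z" by blast
      have "F (2 ^ j / 2) \<le> F (2 ^ j)" using elim by (intro x0(2)) auto
      moreover have "real (norm1 z) \<le> 2 * real CARD('d) * 2 ^ j"
        using of_nat_mono[OF norm1_dyadic_corner[OF z(1)], where 'a = real] by simp
      ultimately show "F (2 ^ j) / 32 \<le> pam_growth_rate V (scale_time (64 * real CARD('d)) F (2 ^ j))"
        using elim(1) z(2) by (meson less_imp_le order_trans)
    qed
  qed
  from frequently_mp[OF this peaks] show ?thesis .
qed

end

section \<open>Logarithmic asymptotics\<close>

context
  fixes F \<tau> :: "real \<Rightarrow> real" and \<beta> \<kappa> \<mu> q C K :: real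
  assumes F_def: "F = log_scale \<beta> \<kappa> \<mu>" and \<tau>_def: "\<tau> = scale_time K F" and \<beta>: "0 < \<beta>" "\<beta> < 1" and q: "q = \<beta> / (1 - \<beta>)" and C: "0 < C" and K: "0 < K"
begin

text \<open>
  The leading terms cancel because \<open>q * (1 - \<beta>) = \<beta>\<close>. The coefficient of \<open>ln (ln x)\<close> decides the
  limit, unless it vanishes, in which case \<open>ln (ln (ln x))\<close> takes over.
\<close>

lemma log_excess_eq:
  "\<forall>\<^sub>F x in at_top. ln (C * F x) - q * ln (\<tau> x)
     = ln C - q * ln K + (\<kappa> - q * (1 - \<kappa>)) * ln (ln x) + \<mu> * (1 + q) * ln (ln (ln x))"
  using eventually_ln_ln_pos
proof eventually_elim
  case (elim x)
  have Fx: "0 < F x" unfolding F_def using elim by (intro log_scale_pos) auto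
  have 1: "ln (C * F x) = ln C + (\<beta> * ln x + \<kappa> * ln (ln x) + \<mu> * ln (ln (ln x)))"
    using C Fx elim by (simp add: F_def ln_mult ln_log_scale)
  have "x \<noteq> 1" using elim by auto
  then have "ln (\<tau> x) = ln K + (ln x + ln (ln x) - ln (F x))"
    using K Fx elim by (simp add: \<tau>_def scale_time_def ln_mult ln_div)
  then have 2: "ln (\<tau> x) = ln K + (ln x + ln (ln x) - (\<beta> * ln x + \<kappa> * ln (ln x) + \<mu> * ln (ln (ln x))))"
    using elim by (simp add: F_def ln_log_scale)
  have "q * (1 - \<beta>) = \<beta>" using \<beta> q by simp
  then have "\<beta> * ln x = q * (1 - \<beta>) * ln x" by simp
  then show ?case unfolding 1 2 by (simp add: algebra_simps)
qed

lemma log_excess_tendsto: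
  "((\<lambda>x. (ln (C * F x) - q * ln (\<tau> x)) / ln (ln (\<tau> x))) \<longlongrightarrow> \<kappa> - q * (1 - \<kappa>)) at_top"
proof -
  have 1: "((\<lambda>x. 1 / ln (ln (\<tau> x))) \<longlongrightarrow> 0) at_top"
    unfolding \<tau>_def scale_time_def F_def log_scale_def using \<beta> K by real_asymp
  have 2: "((\<lambda>x. ln (ln x) / ln (ln (\<tau> x))) \<longlongrightarrow> 1) at_top"
    unfolding \<tau>_def scale_time_def F_def log_scale_def using \<beta> K by real_asymp
  have 3: "((\<lambda>x. ln (ln (ln x)) / ln (ln (\<tau> x))) \<longlongrightarrow> 0) at_top"
    unfolding \<tau>_def scale_time_def F_def log_scale_def using \<beta> K by real_asymp
  have "((\<lambda>x. (ln C - q * ln K) * (1 / ln (ln (\<tau> x))) + (\<kappa> - q * (1 - \<kappa>)) * (ln (ln x) / ln (ln (\<tau> x)))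
      + \<mu> * (1 + q) * (ln (ln (ln x)) / ln (ln (\<tau> x))))
      \<longlongrightarrow> (ln C - q * ln K) * 0 + (\<kappa> - q * (1 - \<kappa>)) * 1 + \<mu> * (1 + q) * 0) at_top"
    by (intro tendsto_intros 1 2 3)
  then have "((\<lambda>x. (ln C - q * ln K) * (1 / ln (ln (\<tau> x))) + (\<kappa> - q * (1 - \<kappa>)) * (ln (ln x) / ln (ln (\<tau> x)))
      + \<mu> * (1 + q) * (ln (ln (ln x)) / ln (ln (\<tau> x)))) \<longlongrightarrow> \<kappa> - q * (1 - \<kappa>)) at_top" by simp
  then show ?thesis
    by (rule Lim_transform_eventually) (use log_excess_eq in eventually_elim, simp add: add_divide_distrib)
qed

lemma log_excess_tendsto_critical:
  assumes crit: "\<kappa> = q * (1 - \<kappa>)"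
  shows "((\<lambda>x. (ln (C * F x) - q * ln (\<tau> x)) / ln (ln (ln (\<tau> x)))) \<longlongrightarrow> \<mu> * (1 + q)) at_top"
proof -
  have 1: "((\<lambda>x. 1 / ln (ln (ln (\<tau> x)))) \<longlongrightarrow> 0) at_top"
    unfolding \<tau>_def scale_time_def F_def log_scale_def using \<beta> K by real_asymp
  have 2: "((\<lambda>x. ln (ln (ln x)) / ln (ln (ln (\<tau> x)))) \<longlongrightarrow> 1) at_top"
    unfolding \<tau>_def scale_time_def F_def log_scale_def using \<beta> K by real_asymp
  have "((\<lambda>x. (ln C - q * ln K) * (1 / ln (ln (ln (\<tau> x))))
      + \<mu> * (1 + q) * (ln (ln (ln x)) / ln (ln (ln (\<tau> x)))))
      \<longlongrightarrow> (ln C - q * ln K) * 0 + \<mu> * (1 + q) * 1) at_top"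
    by (intro tendsto_intros 1 2)
  then have "((\<lambda>x. (ln C - q * ln K) * (1 / ln (ln (ln (\<tau> x))))
      + \<mu> * (1 + q) * (ln (ln (ln x)) / ln (ln (ln (\<tau> x))))) \<longlongrightarrow> \<mu> * (1 + q)) at_top" by simp
  moreover have "\<forall>\<^sub>F x in at_top. (ln C - q * ln K) * (1 / ln (ln (ln (\<tau> x))))
      + \<mu> * (1 + q) * (ln (ln (ln x)) / ln (ln (ln (\<tau> x)))) = (ln (C * F x) - q * ln (\<tau> x)) / ln (ln (ln (\<tau> x)))"
    using log_excess_eq
  proof eventually_elim
    case (elim x)
    have "\<kappa> - q * (1 - \<kappa>) = 0" using crit by linarith
    with elim have "ln (C * F x) - q * ln (\<tau> x) = ln C - q * ln K + \<mu> * (1 + q) * ln (ln (ln x))" by simp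
    then show ?case by (simp add: add_divide_distrib)
  qed
  ultimately show ?thesis by (rule Lim_transform_eventually)
qed

end

text \<open>
  The bounds on the growth rate compare it with real numbers; this rule and the three analogous ones turn
  such comparisons into bounds on upper and lower limits in the extended reals.
\<close>

lemma ereal_le_LimsupI:
  fixes X :: "real \<Rightarrow> real"
  assumes "\<And>y. y < l \<Longrightarrow> \<exists>\<^sub>F t in at_top. y < X t"
  shows "ereal l \<le> Limsup at_top (\<lambda>t. ereal (X t))"
proof (rule ccontr)
  assume "\<not> ereal l \<le> Limsup at_top (\<lambda>t. ereal (X t))"
  then have "Limsup at_top (\<lambda>t. ereal (X t)) < ereal l" by (simp only: not_le)
  from ereal_dense2[OF this] obtain y
    where y: "Limsup at_top (\<lambda>t. ereal (X t)) < ereal y" "ereal y < ereal l" by blast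
  have "\<forall>\<^sub>F t in at_top. ereal (X t) < ereal y"
    using y(1) by (rule Limsup_lessD)
  then have "\<forall>\<^sub>F t in at_top. \<not> y < X t" by eventually_elim simp
  moreover have "\<exists>\<^sub>F t in at_top. y < X t" using assms y(2) by simp
  ultimately show False by (simp add: frequently_def)
qed

lemma Limsup_le_erealI:
  fixes X :: "real \<Rightarrow> real"
  assumes "\<And>y. l < y \<Longrightarrow> \<forall>\<^sub>F t in at_top. X t < y"
  shows "Limsup at_top (\<lambda>t. ereal (X t)) \<le> ereal l"
  unfolding Limsup_le_iff
proof (intro allI impI)
  fix y assume "ereal l < y"
  then obtain r where r: "ereal l < ereal r" "ereal r < y" using ereal_dense2 by blast
  have "\<forall>\<^sub>F t in at_top. X t < r" using assms r(1) by simp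
  then show "\<forall>\<^sub>F t in at_top. ereal (X t) < y"
    by eventually_elim (rule less_trans[OF _ r(2)], simp)
qed

lemma ereal_uminus_Limsup: "Limsup at_top (\<lambda>t. ereal (- X t)) = - Liminf at_top (\<lambda>t::real. ereal (X t))"
  using ereal_Limsup_uminus[of at_top "\<lambda>t::real. ereal (X t)"] by simp

lemma ereal_le_LiminfI:
  fixes X :: "real \<Rightarrow> real"
  assumes "\<And>y. y < l \<Longrightarrow> \<forall>\<^sub>F t in at_top. y < X t"
  shows "ereal l \<le> Liminf at_top (\<lambda>t. ereal (X t))"
proof -
  have "Limsup at_top (\<lambda>t. ereal (- X t)) \<le> ereal (- l)"
  proof (rule Limsup_le_erealI)
    fix y assume "- l < y"
    then have "\<forall>\<^sub>F t in at_top. - y < X t" by (intro assms) simp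
    then show "\<forall>\<^sub>F t in at_top. - X t < y" by eventually_elim simp
  qed
  then show ?thesis
    unfolding ereal_uminus_Limsup by (metis ereal_minus_le_minus uminus_ereal.simps(1))
qed

lemma Liminf_le_erealI:
  fixes X :: "real \<Rightarrow> real"
  assumes "\<And>y. l < y \<Longrightarrow> \<exists>\<^sub>F t in at_top. X t < y"
  shows "Liminf at_top (\<lambda>t. ereal (X t)) \<le> ereal l"
proof -
  have "ereal (- l) \<le> Limsup at_top (\<lambda>t. ereal (- X t))"
  proof (rule ereal_le_LimsupI)
    fix y assume "y < - l"
    then have "\<exists>\<^sub>F t in at_top. X t < - y" by (intro assms) simp
    then show "\<exists>\<^sub>F t in at_top. y < - X t" by (rule frequently_elim1) simp
  qed
  then show ?thesis
    unfolding ereal_uminus_Limsup by (metis ereal_minus_le_minus uminus_ereal.simps(1))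
qed

text \<open>
  Transfer from the parametrisation to time. The growth rate \<open>L\<close> is compared with \<open>G\<close> along
  \<open>\<tau>\<close>: from one side at all large \<open>x\<close> for an upper bound on the upper limit or a lower bound on
  the lower limit, and at infinitely many powers of two for the two reverse bounds.
\<close>

context
  fixes L W G \<tau> :: "real \<Rightarrow> real" and q l :: real
  assumes \<tau>: "filterlim \<tau> at_top at_top"
    and W: "\<forall>\<^sub>F t in at_top. 0 < W t" and G: "\<forall>\<^sub>F x in at_top. 0 < G x"
    and lim: "((\<lambda>x. (ln (G x) - q * ln (\<tau> x)) / W (\<tau> x)) \<longlongrightarrow> l) at_top"
begin

lemma Limsup_excess_le:
  assumes cont: "continuous_on {x0..} \<tau>" and L: "\<forall>\<^sub>F t in at_top. 0 < L t"
    and le: "\<forall>\<^sub>F x in at_top. L (\<tau> x) \<le> G x"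
  shows "Limsup at_top (\<lambda>t. ereal ((ln (L t) - q * ln t) / W t)) \<le> ereal l"
proof (rule Limsup_le_erealI, rule eventually_at_top_range[OF \<tau> cont])
  fix y assume "l < y"
  with lim have "\<forall>\<^sub>F x in at_top. (ln (G x) - q * ln (\<tau> x)) / W (\<tau> x) < y"
    by (rule order_tendstoD(2))
  with le eventually_compose_filterlim[OF W \<tau>] eventually_compose_filterlim[OF L \<tau>]
  show "\<forall>\<^sub>F x in at_top. (ln (L (\<tau> x)) - q * ln (\<tau> x)) / W (\<tau> x) < y"
  proof eventually_elim
    case (elim x)
    have "ln (L (\<tau> x)) \<le> ln (G x)" using elim by (subst ln_le_cancel_iff) auto
    then have "(ln (L (\<tau> x)) - q * ln (\<tau> x)) / W (\<tau> x) \<le> (ln (G x) - q * ln (\<tau> x)) / W (\<tau> x)"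
      using elim by (intro divide_right_mono) auto
    then show ?case using elim by linarith
  qed
qed

lemma Liminf_excess_ge:
  assumes cont: "continuous_on {x0..} \<tau>"
    and ge: "\<forall>\<^sub>F x in at_top. G x \<le> L (\<tau> x)"
  shows "ereal l \<le> Liminf at_top (\<lambda>t. ereal ((ln (L t) - q * ln t) / W t))"
proof (rule ereal_le_LiminfI, rule eventually_at_top_range[OF \<tau> cont])
  fix y assume "y < l"
  with lim have "\<forall>\<^sub>F x in at_top. y < (ln (G x) - q * ln (\<tau> x)) / W (\<tau> x)"
    by (rule order_tendstoD(1))
  with ge eventually_compose_filterlim[OF W \<tau>] G
  show "\<forall>\<^sub>F x in at_top. y < (ln (L (\<tau> x)) - q * ln (\<tau> x)) / W (\<tau> x)"
  proof eventually_elim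
    case (elim x)
    have "ln (G x) \<le> ln (L (\<tau> x))" using elim by (subst ln_le_cancel_iff) auto
    then have "(ln (G x) - q * ln (\<tau> x)) / W (\<tau> x) \<le> (ln (L (\<tau> x)) - q * ln (\<tau> x)) / W (\<tau> x)"
      using elim by (intro divide_right_mono) auto
    then show ?case using elim by linarith
  qed
qed

lemma Limsup_excess_ge:
  assumes ge: "\<exists>\<^sub>F j in sequentially. G (2 ^ j) \<le> L (\<tau> (2 ^ j))"
  shows "ereal l \<le> Limsup at_top (\<lambda>t. ereal ((ln (L t) - q * ln t) / W t))"
proof (rule ereal_le_LimsupI)
  have seq: "filterlim (\<lambda>j. (2 :: real) ^ j) at_top sequentially" by real_asymp
  fix y assume "y < l"
  with lim have "\<forall>\<^sub>F x in at_top. y < (ln (G x) - q * ln (\<tau> x)) / W (\<tau> x)"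
    by (rule order_tendstoD(1))
  with eventually_compose_filterlim[OF W \<tau>] G
  have "\<forall>\<^sub>F x in at_top. G x \<le> L (\<tau> x) \<longrightarrow> y < (ln (L (\<tau> x)) - q * ln (\<tau> x)) / W (\<tau> x)"
  proof (eventually_elim, intro impI)
    fix x assume a: "0 < W (\<tau> x)" "0 < G x" "y < (ln (G x) - q * ln (\<tau> x)) / W (\<tau> x)" "G x \<le> L (\<tau> x)"
    have "ln (G x) \<le> ln (L (\<tau> x))" using a by (subst ln_le_cancel_iff) auto
    then have "(ln (G x) - q * ln (\<tau> x)) / W (\<tau> x) \<le> (ln (L (\<tau> x)) - q * ln (\<tau> x)) / W (\<tau> x)"
      using a by (intro divide_right_mono) auto
    then show "y < (ln (L (\<tau> x)) - q * ln (\<tau> x)) / W (\<tau> x)" using a by linarith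
  qed
  from frequently_mp[OF eventually_compose_filterlim[OF this seq] ge]
  have "\<exists>\<^sub>F j in sequentially. y < (ln (L (\<tau> (2 ^ j))) - q * ln (\<tau> (2 ^ j))) / W (\<tau> (2 ^ j))" .
  then show "\<exists>\<^sub>F t in at_top. y < (ln (L t) - q * ln t) / W t"
    unfolding frequently_def
    by (blast dest: eventually_compose_filterlim[OF _ filterlim_compose[OF \<tau> seq]])
qed

lemma Liminf_excess_le:
  assumes L: "\<forall>\<^sub>F t in at_top. 0 < L t"
    and le: "\<exists>\<^sub>F j in sequentially. L (\<tau> (2 ^ j)) \<le> G (2 ^ j)"
  shows "Liminf at_top (\<lambda>t. ereal ((ln (L t) - q * ln t) / W t)) \<le> ereal l"
proof (rule Liminf_le_erealI)
  have seq: "filterlim (\<lambda>j. (2 :: real) ^ j) at_top sequentially" by real_asymp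
  fix y assume "l < y"
  with lim have "\<forall>\<^sub>F x in at_top. (ln (G x) - q * ln (\<tau> x)) / W (\<tau> x) < y"
    by (rule order_tendstoD(2))
  with eventually_compose_filterlim[OF W \<tau>] eventually_compose_filterlim[OF L \<tau>]
  have "\<forall>\<^sub>F x in at_top. L (\<tau> x) \<le> G x \<longrightarrow> (ln (L (\<tau> x)) - q * ln (\<tau> x)) / W (\<tau> x) < y"
  proof (eventually_elim, intro impI)
    fix x assume a: "0 < W (\<tau> x)" "0 < L (\<tau> x)" "(ln (G x) - q * ln (\<tau> x)) / W (\<tau> x) < y" "L (\<tau> x) \<le> G x"
    have "ln (L (\<tau> x)) \<le> ln (G x)" using a by (subst ln_le_cancel_iff) auto
    then have "(ln (L (\<tau> x)) - q * ln (\<tau> x)) / W (\<tau> x) \<le> (ln (G x) - q * ln (\<tau> x)) / W (\<tau> x)"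
      using a by (intro divide_right_mono) auto
    then show "(ln (L (\<tau> x)) - q * ln (\<tau> x)) / W (\<tau> x) < y" using a by linarith
  qed
  from frequently_mp[OF eventually_compose_filterlim[OF this seq] le]
  have "\<exists>\<^sub>F j in sequentially. (ln (L (\<tau> (2 ^ j))) - q * ln (\<tau> (2 ^ j))) / W (\<tau> (2 ^ j)) < y" .
  then show "\<exists>\<^sub>F t in at_top. (ln (L t) - q * ln t) / W t < y"
    unfolding frequently_def
    by (blast dest: eventually_compose_filterlim[OF _ filterlim_compose[OF \<tau> seq]])
qed

end

text \<open>
  The terms are compared with the differences of \<open>ln j powr (- e)\<close>, whose sum telescopes.
\<close>

lemma summable_bertrand_dyadic:
  assumes e: "0 < (e :: real)"
  shows "summable (\<lambda>j. ln (2 ^ j) powr - 1 * ln (ln (2 ^ j)) powr (- (1 + e)) :: real)"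
proof (rule summable_comparison_test_bigo)
  define g where "g = (\<lambda>j::nat. ln (real j) powr (- e) - ln (real (Suc j)) powr (- e))"
  have "(\<lambda>j::nat. ln (real j) powr (- e)) \<longlonglongrightarrow> 0" using e by real_asymp
  from telescope_summable'[OF this] have "summable g" by (simp add: g_def)
  moreover have "\<forall>\<^sub>F j in sequentially. norm (g j) = g j"
  proof -
    have "\<forall>\<^sub>F j in sequentially. 0 \<le> g j" unfolding g_def using e by real_asymp
    then show ?thesis by eventually_elim simp
  qed
  ultimately show "summable (\<lambda>j. norm (g j))" using summable_cong[of "\<lambda>j. norm (g j)" g] by simp
  show "(\<lambda>j. ln (2 ^ j) powr - 1 * ln (ln (2 ^ j)) powr (- (1 + e)) :: real) \<in> O(g)"
    unfolding g_def using e by real_asymp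
qed

text \<open>
  The terms dominate the differences of \<open>ln (ln j)\<close>, whose sum telescopes and diverges.
\<close>

lemma not_summable_bertrand_dyadic:
  "\<not> summable (\<lambda>j. ln (2 ^ j) powr - 1 * ln (ln (2 ^ j)) powr (- 1) :: real)"
proof
  define f where "f = (\<lambda>j. ln (2 ^ j) powr - 1 * ln (ln (2 ^ j)) powr (- 1) :: real)"
  define h where "h = (\<lambda>j::nat. ln (ln (real j)))"
  assume "summable (\<lambda>j. ln (2 ^ j) powr - 1 * ln (ln (2 ^ j)) powr (- 1) :: real)"
  then have "summable (\<lambda>j. norm (f j))" by (simp add: f_def)
  moreover have "(\<lambda>j. h (Suc j) - h j) \<in> O(f)"
    unfolding f_def h_def by real_asymp
  ultimately have "summable (\<lambda>j. h (Suc j) - h j)"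
    by (rule summable_comparison_test_bigo)
  then have "(\<lambda>n. \<Sum>j<n. h (Suc j) - h j) \<longlonglongrightarrow> (\<Sum>j. h (Suc j) - h j)" by (rule summable_LIMSEQ)
  then have "(\<lambda>n. h n - h 0) \<longlonglongrightarrow> (\<Sum>j. h (Suc j) - h j)" by (simp add: sum_lessThan_telescope)
  moreover have "filterlim (\<lambda>n. h n - h 0) at_top sequentially"
    unfolding h_def by real_asymp
  ultimately show False
    using not_tendsto_and_filterlim_at_infinity[OF sequentially_bot] filterlim_at_top_imp_at_infinity by blast
qed

lemma summable_exp_neg_dyadic:
  assumes e: "0 < (e :: real)"
  shows "summable (\<lambda>j. exp (- (ln (2 ^ j) powr e)) :: real)"
proof (rule summable_comparison_test_ev)
  show "summable (\<lambda>j. inverse (real j ^ 2))"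
    using inverse_power_summable[of 2, where 'a = real] by simp
  have "\<forall>\<^sub>F j in sequentially. 2 * ln (real j) \<le> ln (2 ^ j) powr e"
    using e by real_asymp
  then show "\<forall>\<^sub>F j in sequentially. norm (exp (- (ln (2 ^ j) powr e)) :: real) \<le> inverse (real j ^ 2)"
    using eventually_gt_at_top[of 0]
  proof eventually_elim
    case (elim j)
    then have "exp (- (ln (2 ^ j) powr e)) \<le> exp (- (2 * ln (real j)))" by simp
    also have "\<dots> = inverse (real j ^ 2)"
      using elim by (simp add: exp_minus exp_double)
    finally show ?case by simp
  qed
qed

section \<open>Almost sure fluctuations\<close>

context pareto_field
begin

text \<open>
  The exponent \<open>d / \<alpha>\<close> is the one for which the expected number of exceedances in a box of side
  \<open>x\<close> depends on \<open>x\<close> through logarithms only.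
\<close>

lemma dyadic_intensity:
  assumes "0 < ln (ln x)" "0 < ln x" "0 < (x :: real)"
  shows "x ^ CARD('d) * log_scale (real CARD('d) / \<alpha>) \<kappa> \<mu> x powr (- \<alpha>)
     = ln x powr (- (\<alpha> * \<kappa>)) * ln (ln x) powr (- (\<alpha> * \<mu>))"
proof -
  have "(x powr (real CARD('d) / \<alpha>)) powr (- \<alpha>) = x powr (- real CARD('d))"
    using alpha_pos by (simp add: powr_powr)
  also have "\<dots> = inverse (x ^ CARD('d))"
    using assms by (simp add: powr_minus powr_realpow)
  finally show ?thesis
    using assms by (simp add: log_scale_def powr_mult powr_powr mult.commute)
qed

lemma eventually_dyadic_intensity:
  "\<forall>\<^sub>F j in sequentially. ln (2 ^ j) powr (- (\<alpha> * \<kappa>)) * ln (ln (2 ^ j)) powr (- (\<alpha> * \<mu>))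
     = (2 ^ j) ^ CARD('d) * log_scale (real CARD('d) / \<alpha>) \<kappa> \<mu> (2 ^ j) powr (- \<alpha>)"
proof -
  have "filterlim (\<lambda>j. (2 :: real) ^ j) at_top sequentially" by real_asymp
  from eventually_compose_filterlim[OF eventually_ln_ln_pos this] show ?thesis
    by eventually_elim (simp add: dyadic_intensity)
qed

lemma beta_bounds: "0 < real CARD('d) / \<alpha>" "real CARD('d) / \<alpha> < 1"
  using alpha alpha_pos by (simp_all add: divide_less_eq)

lemma eventually_dyadic_scale_ge_1:
  "\<forall>\<^sub>F j in sequentially. 1 \<le> log_scale (real CARD('d) / \<alpha>) \<kappa> \<mu> (2 ^ j)"
proof -
  have "filterlim (\<lambda>j. (2 :: real) ^ j) at_top sequentially" by real_asymp
  from filterlim_compose[OF filterlim_log_scale[OF refl beta_bounds] this]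
  show ?thesis by (simp add: filterlim_at_top)
qed

text \<open>
  The intensities form the series \<open>1 / (j * (ln j) ^ (1 + e))\<close> up to constants, which converges.
\<close>

lemma AE_envelope:
  assumes "0 < e"
  shows "AE \<omega> in M. \<forall>\<^sub>F j in sequentially. \<forall>z\<in>dyadic_box j.
     \<xi> z \<omega> \<le> log_scale (real CARD('d) / \<alpha>) (1 / \<alpha>) ((1 + e) / \<alpha>) (2 ^ j)"
proof (rule AE_eventually_below[OF eventually_dyadic_scale_ge_1])
  show "summable (\<lambda>j. (2 ^ j) ^ CARD('d) * log_scale (real CARD('d) / \<alpha>) (1 / \<alpha>) ((1 + e) / \<alpha>) (2 ^ j) powr (- \<alpha>))"
    using summable_bertrand_dyadic[OF assms] alpha_pos
      summable_cong[OF eventually_dyadic_intensity[of "1 / \<alpha>" "(1 + e) / \<alpha>"]] by simp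
qed

text \<open>
  The intensities form the series \<open>1 / (j * ln j)\<close> up to constants, which diverges.
\<close>

lemma AE_record_peaks:
  "AE \<omega> in M. \<exists>\<^sub>F j in sequentially. \<exists>z\<in>dyadic_corner j.
     log_scale (real CARD('d) / \<alpha>) (1 / \<alpha>) (1 / \<alpha>) (2 ^ j) < \<xi> z \<omega>"
proof (rule AE_frequently_exceeds[OF eventually_dyadic_scale_ge_1])
  show "\<not> summable (\<lambda>j. (2 ^ j) ^ CARD('d) * log_scale (real CARD('d) / \<alpha>) (1 / \<alpha>) (1 / \<alpha>) (2 ^ j) powr (- \<alpha>))"
    using not_summable_bertrand_dyadic alpha_pos
      summable_cong[OF eventually_dyadic_intensity[of "1 / \<alpha>" "1 / \<alpha>"]] by simp
qed

text \<open>
  A power of \<open>ln x\<close> below the typical maximum, the intensity is \<open>j powr (\<alpha> * e)\<close> up to a constant,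
  and the probability of missing such a peak is summable over the scales.
\<close>

lemma AE_typical_peaks:
  assumes "0 < e"
  shows "AE \<omega> in M. \<forall>\<^sub>F j in sequentially. \<exists>z\<in>dyadic_corner j.
     log_scale (real CARD('d) / \<alpha>) (- e) 0 (2 ^ j) < \<xi> z \<omega>"
proof (rule AE_eventually_exceeds[OF eventually_dyadic_scale_ge_1])
  have "\<forall>\<^sub>F j in sequentially. exp (- (ln (2 ^ j) powr (\<alpha> * e))) =
      exp (- ((2 ^ j) ^ CARD('d) * log_scale (real CARD('d) / \<alpha>) (- e) 0 (2 ^ j) powr (- \<alpha>)))"
  proof -
    have "\<forall>\<^sub>F j in sequentially. 0 < ln (ln ((2 :: real) ^ j))" by real_asymp
    with eventually_dyadic_intensity[of "- e" 0] show ?thesis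
      by eventually_elim simp
  qed
  from summable_cong[OF this]
  show "summable (\<lambda>j. exp (- ((2 ^ j) ^ CARD('d) * log_scale (real CARD('d) / \<alpha>) (- e) 0 (2 ^ j) powr (- \<alpha>))))"
    using summable_exp_neg_dyadic[of "\<alpha> * e"] assms alpha_pos by simp
qed

text \<open>
  A power of \<open>ln x\<close> above the typical maximum, the intensity tends to zero.
\<close>

lemma AE_typical_cone:
  assumes "0 < e"
  shows "AE \<omega> in M. \<exists>\<^sub>F j in sequentially. \<forall>z. \<xi> z \<omega> \<le>
     log_scale (real CARD('d) / \<alpha>) e 0 (2 ^ j) + log_scale (real CARD('d) / \<alpha>) e 0 (2 ^ j) / 2 ^ j * norm1 z"
proof (rule AE_frequently_below_cone[OF eventually_dyadic_scale_ge_1])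
  have p: "0 < \<alpha> * e" using assms alpha_pos by simp
  have "(\<lambda>j. ln (2 ^ j) powr (- (\<alpha> * e)) * ln (ln (2 ^ j)) powr (- (\<alpha> * 0)) :: real) \<longlonglongrightarrow> 0"
  proof -
    have "(\<lambda>j. ln (2 ^ j) powr (- (\<alpha> * e)) * ln (ln (2 ^ j)) powr 0 :: real) \<longlonglongrightarrow> 0"
      using p by real_asymp
    then show ?thesis by simp
  qed
  then show "(\<lambda>j. (2 ^ j) ^ CARD('d) * log_scale (real CARD('d) / \<alpha>) e 0 (2 ^ j) powr (- \<alpha>)) \<longlonglongrightarrow> 0"
    by (rule Lim_transform_eventually) (rule eventually_dyadic_intensity)
qed

end

lemma LIMSEQ_add_inverse: "(\<lambda>m. ereal (l + c * inverse (real (Suc m)))) \<longlonglongrightarrow> ereal l"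
proof -
  have "(\<lambda>m. l + c * inverse (real (Suc m))) \<longlonglongrightarrow> l + c * 0"
    by (intro tendsto_intros LIMSEQ_inverse_real_of_nat)
  then show ?thesis by simp
qed

theorem theorem1p1:
  fixes M :: "'w measure"
    and \<xi> :: "int ^ 'd::finite \<Rightarrow> 'w \<Rightarrow> real"
    and \<alpha> :: real
  assumes "prob_space M"
    and "prob_space.indep_vars M (\<lambda>_. borel) \<xi> UNIV"
    and "\<And>z x. measure M {\<omega> \<in> space M. \<xi> z \<omega> \<le> x} = (if x < 1 then 0 else 1 - x powr (- \<alpha>))"
    and "\<alpha> > real CARD('d)"
  shows "AE \<omega> in M.
    (let d = real CARD('d); L = pam_growth_rate (\<lambda>z. \<xi> z \<omega>) in
      (d > 1 \<longrightarrow>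
         Limsup at_top (\<lambda>t. ereal ((ln (L t) - d / (\<alpha> - d) * ln t) / ln (ln t)))
           = ereal (- ((d - 1) / (\<alpha> - d)))) \<and>
      (d = 1 \<longrightarrow>
         Limsup at_top (\<lambda>t. ereal ((ln (L t) - d / (\<alpha> - d) * ln t) / ln (ln (ln t))))
           = ereal (1 / (\<alpha> - d))) \<and>
      Liminf at_top (\<lambda>t. ereal ((ln (L t) - d / (\<alpha> - d) * ln t) / ln (ln t)))
        = ereal (- (d / (\<alpha> - d))))"
proof -
  interpret prob_space M by fact
  interpret pareto_field M \<xi> \<alpha>
    by unfold_locales (use assms in auto)
  define d where "d = real CARD('d)"
  define \<beta> where "\<beta> = d / \<alpha>"
  define q where "q = d / (\<alpha> - d)"
  have d: "1 \<le> d" by (simp add: d_def Suc_leI)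
  have ad: "d < \<alpha>" "0 < \<alpha>" using alpha alpha_pos by (auto simp: d_def)
  have \<beta>: "0 < \<beta>" "\<beta> < 1" using beta_bounds by (simp_all add: \<beta>_def d_def)
  have q: "q = \<beta> / (1 - \<beta>)" using ad by (simp add: q_def \<beta>_def field_simps)
  have q1: "1 + q = \<alpha> / (\<alpha> - d)" using ad by (simp add: q_def field_simps)
  \<comment> \<open>a sequence of error exponents, so that countably many almost sure events suffice\<close>
  define e where "e = (\<lambda>m. inverse (real (Suc m)))"
  have e: "0 < e m" for m by (simp add: e_def)
  \<comment> \<open>the envelope of the potential, the records reached infinitely often, and the lower and upper
      bounds for its typical maximum\<close>
  define up where "up = (\<lambda>m. log_scale \<beta> (1 / \<alpha>) ((1 + e m) / \<alpha>))"
  define rec where "rec = log_scale \<beta> (1 / \<alpha>) (1 / \<alpha>)"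
  define lo where "lo = (\<lambda>m. log_scale \<beta> (- e m) 0)"
  define ty where "ty = (\<lambda>m. log_scale \<beta> (e m) 0)"
  have up_eq: "up m = log_scale \<beta> (1 / \<alpha>) ((1 + e m) / \<alpha>)" for m by (simp add: up_def)
  have lo_eq: "lo m = log_scale \<beta> (- e m) 0" for m by (simp add: lo_def)
  have ty_eq: "ty m = log_scale \<beta> (e m) 0" for m by (simp add: ty_def)
  have ev_W1: "\<forall>\<^sub>F t::real in at_top. 0 < ln (ln t)" by real_asymp
  have ev_W2: "\<forall>\<^sub>F t::real in at_top. 0 < ln (ln (ln t))" by real_asymp
  have scale_eventually_pos: "\<forall>\<^sub>F x in at_top. 0 < C * log_scale \<beta> \<kappa> \<mu> x" if "0 < C" for C \<kappa> \<mu>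
    using eventually_ln_ln_pos by eventually_elim (simp add: that log_scale_pos)
  have time_lim: "filterlim (scale_time K (log_scale \<beta> \<kappa> \<mu>)) at_top at_top" if "0 < K" for K \<kappa> \<mu>
    by (rule filterlim_scale_time[OF refl \<beta> that])
  have time_cont: "continuous_on {exp (exp 1)..} (scale_time K (log_scale \<beta> \<kappa> \<mu>))" for K \<kappa> \<mu>
    by (rule continuous_on_scale_time[OF refl \<beta>])
  have excess_lim: "((\<lambda>x. (ln (C * log_scale \<beta> \<kappa> \<mu> x) - q * ln (scale_time K (log_scale \<beta> \<kappa> \<mu>) x))
      / ln (ln (scale_time K (log_scale \<beta> \<kappa> \<mu>) x))) \<longlongrightarrow> \<kappa> - q * (1 - \<kappa>)) at_top"
    if "0 < C" "0 < K" for C K \<kappa> \<mu>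
    by (rule log_excess_tendsto[OF refl refl \<beta> q that])
  have excess_lim_crit: "((\<lambda>x. (ln (C * log_scale \<beta> \<kappa> \<mu> x) - q * ln (scale_time K (log_scale \<beta> \<kappa> \<mu>) x))
      / ln (ln (ln (scale_time K (log_scale \<beta> \<kappa> \<mu>) x)))) \<longlongrightarrow> \<mu> * (1 + q)) at_top"
    if "0 < C" "0 < K" "\<kappa> = q * (1 - \<kappa>)" for C K \<kappa> \<mu>
    by (rule log_excess_tendsto_critical[OF refl refl \<beta> q that])
  have "AE \<omega> in M. (\<forall>z. 0 \<le> \<xi> z \<omega>)
    \<and> (\<forall>m. \<forall>\<^sub>F j in sequentially. \<forall>z\<in>dyadic_box j. \<xi> z \<omega> \<le> up m (2 ^ j))
    \<and> (\<exists>\<^sub>F j in sequentially. \<exists>z\<in>dyadic_corner j. rec (2 ^ j) < \<xi> z \<omega>)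
    \<and> (\<forall>m. \<forall>\<^sub>F j in sequentially. \<exists>z\<in>dyadic_corner j. lo m (2 ^ j) < \<xi> z \<omega>)
    \<and> (\<forall>m. \<exists>\<^sub>F j in sequentially. \<forall>z. \<xi> z \<omega> \<le> ty m (2 ^ j) + ty m (2 ^ j) / 2 ^ j * norm1 z)"
    unfolding up_def rec_def lo_def ty_def \<beta>_def d_def
    using AE_nonneg AE_envelope[OF e] AE_record_peaks AE_typical_peaks[OF e] AE_typical_cone[OF e]
    by (simp add: AE_all_countable)
  then show ?thesis
  proof (rule AE_mp, intro AE_I2 impI, elim conjE)
    fix \<omega>
    define V where "V = (\<lambda>z. \<xi> z \<omega>)"
    define L where "L = pam_growth_rate V"
    assume "\<forall>z. 0 \<le> \<xi> z \<omega>"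
      and "\<forall>m. \<forall>\<^sub>F j in sequentially. \<forall>z\<in>dyadic_box j. \<xi> z \<omega> \<le> up m (2 ^ j)"
      and "\<exists>\<^sub>F j in sequentially. \<exists>z\<in>dyadic_corner j. rec (2 ^ j) < \<xi> z \<omega>"
      and "\<forall>m. \<forall>\<^sub>F j in sequentially. \<exists>z\<in>dyadic_corner j. lo m (2 ^ j) < \<xi> z \<omega>"
      and "\<forall>m. \<exists>\<^sub>F j in sequentially. \<forall>z. \<xi> z \<omega> \<le> ty m (2 ^ j) + ty m (2 ^ j) / 2 ^ j * norm1 z"
    then have V0: "\<And>z. 0 \<le> V z"
      and env: "\<And>m. \<forall>\<^sub>F j in sequentially. \<forall>z\<in>dyadic_box j. V z \<le> up m (2 ^ j)"
      and recs: "\<exists>\<^sub>F j in sequentially. \<exists>z\<in>dyadic_corner j. rec (2 ^ j) < V z"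
      and peaks: "\<And>m. \<forall>\<^sub>F j in sequentially. \<exists>z\<in>dyadic_corner j. lo m (2 ^ j) < V z"
      and cone: "\<And>m. \<exists>\<^sub>F j in sequentially. \<forall>z. V z \<le> ty m (2 ^ j) + ty m (2 ^ j) / 2 ^ j * norm1 z"
      unfolding V_def by blast+
    obtain A c :: real where c: "0 \<le> c" and A: "\<And>z. V z \<le> A + c * norm1 z"
      using envelope_linear[OF up_eq[of 0] \<beta> env] by blast
    note V = V0 A c
    have lo_growth: "\<forall>\<^sub>F x in at_top. 1 / 32 * lo m x \<le> L (scale_time (64 * d) (lo m) x)" for m
      using peaks_growth_eventually[OF lo_eq[of m] \<beta> V peaks] by (simp add: L_def d_def)
    \<comment> \<open>the upper bounds need a positive growth rate under the logarithm\<close>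
    have L_pos: "\<forall>\<^sub>F t in at_top. 0 < L t"
    proof (rule eventually_at_top_range)
      show "filterlim (scale_time (64 * d) (lo 0)) at_top at_top"
        using d by (intro filterlim_scale_time[OF lo_eq[of 0] \<beta>]) simp
      show "continuous_on {exp (exp 1)..} (scale_time (64 * d) (lo 0))"
        by (rule continuous_on_scale_time[OF lo_eq[of 0] \<beta>])
      show "\<forall>\<^sub>F x in at_top. 0 < L (scale_time (64 * d) (lo 0) x)"
        using lo_growth[of 0] scale_eventually_pos[OF zero_less_one, of "- e 0" 0] unfolding lo_eq
        by eventually_elim simp
    qed
    have up_growth: "\<forall>\<^sub>F x in at_top. L (scale_time (\<beta> / 4) (up m) x) \<le> 3 * up m x" for m
      using cone_growth[OF up_eq[of m] \<beta> V] envelope_cone[OF up_eq[of m] \<beta> env] log_scale_double[OF up_eq[of m] \<beta>]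
        eventually_gt_at_top[of 0]
    proof eventually_elim
      case (elim x)
      have "V z \<le> 2 * up m x + 2 * up m x / x * norm1 z" for z
      proof -
        have "V z \<le> up m (2 * x) + up m (2 * x) / x * norm1 z" using elim by blast
        also have "\<dots> \<le> 2 * up m x + 2 * up m x / x * norm1 z"
          using elim by (intro add_mono mult_right_mono divide_right_mono) auto
        finally show ?thesis .
      qed
      then show ?case using elim(1) by (simp add: L_def)
    qed
    have rec_growth: "\<exists>\<^sub>F j in sequentially. 1 / 32 * rec (2 ^ j) \<le> L (scale_time (64 * d) rec (2 ^ j))"
      using peaks_growth_frequently[OF rec_def \<beta> V recs] by (simp add: L_def d_def)
    have ty_growth: "\<exists>\<^sub>F j in sequentially. L (scale_time (\<beta> / 4) (ty m) (2 ^ j)) \<le> 3 * ty m (2 ^ j)" for m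
    proof -
      have seq: "filterlim (\<lambda>j. (2 :: real) ^ j) at_top sequentially" by real_asymp
      have "\<forall>\<^sub>F j in sequentially. (\<forall>z. V z \<le> ty m (2 ^ j) + ty m (2 ^ j) / 2 ^ j * norm1 z) \<longrightarrow>
         L (scale_time (\<beta> / 4) (ty m) (2 ^ j)) \<le> 3 * ty m (2 ^ j)"
        using eventually_compose_filterlim[OF cone_growth[OF ty_eq[of m] \<beta> V] seq]
      proof (eventually_elim, intro impI)
        fix j assume g: "(\<forall>z. V z \<le> 2 * ty m (2 ^ j) + 2 * ty m (2 ^ j) / 2 ^ j * norm1 z) \<longrightarrow>
            pam_growth_rate V (scale_time (\<beta> / 4) (ty m) (2 ^ j)) \<le> 3 * ty m (2 ^ j)"
          and le: "\<forall>z. V z \<le> ty m (2 ^ j) + ty m (2 ^ j) / 2 ^ j * norm1 z"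
        have ty0: "0 \<le> ty m (2 ^ j)" by (simp add: ty_eq log_scale_def)
        have "V z \<le> 2 * ty m (2 ^ j) + 2 * ty m (2 ^ j) / 2 ^ j * norm1 z" for z
        proof -
          have "0 \<le> ty m (2 ^ j) / 2 ^ j * norm1 z" using ty0 by simp
          moreover have "V z \<le> ty m (2 ^ j) + ty m (2 ^ j) / 2 ^ j * norm1 z" using le by blast
          moreover have "2 * ty m (2 ^ j) / 2 ^ j * norm1 z = 2 * (ty m (2 ^ j) / 2 ^ j * norm1 z)"
            by simp
          ultimately show ?thesis using ty0 by linarith
        qed
        then show "L (scale_time (\<beta> / 4) (ty m) (2 ^ j)) \<le> 3 * ty m (2 ^ j)"
          using g by (simp add: L_def)
      qed
      from frequently_mp[OF this cone] show ?thesis .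
    qed
    have Liminf_ge: "ereal (- q) \<le> Liminf at_top (\<lambda>t. ereal ((ln (L t) - q * ln t) / ln (ln t)))"
    proof (rule LIMSEQ_le_const2[OF LIMSEQ_add_inverse[of "- q" "- (1 + q)"]], intro exI allI impI)
      fix m
      have "ereal (- e m - q * (1 - - e m)) \<le> Liminf at_top (\<lambda>t. ereal ((ln (L t) - q * ln t) / ln (ln t)))"
        using d unfolding lo_eq
        by (intro Liminf_excess_ge[OF time_lim ev_W1 scale_eventually_pos excess_lim time_cont lo_growth[of m, unfolded lo_eq]]) auto
      moreover have "- e m - q * (1 - - e m) = - q + - (1 + q) * inverse (real (Suc m))"
        by (simp add: e_def algebra_simps)
      ultimately show "ereal (- q + - (1 + q) * inverse (real (Suc m))) \<le> Liminf at_top (\<lambda>t. ereal ((ln (L t) - q * ln t) / ln (ln t)))"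
        by (simp only:)
    qed
    have Liminf_le: "Liminf at_top (\<lambda>t. ereal ((ln (L t) - q * ln t) / ln (ln t))) \<le> ereal (- q)"
    proof (rule LIMSEQ_le_const[OF LIMSEQ_add_inverse[of "- q" "1 + q"]], intro exI allI impI)
      fix m
      have "Liminf at_top (\<lambda>t. ereal ((ln (L t) - q * ln t) / ln (ln t))) \<le> ereal (e m - q * (1 - e m))"
        using \<beta>
        by (intro Liminf_excess_le[OF time_lim ev_W1 scale_eventually_pos excess_lim L_pos ty_growth[of m, unfolded ty_eq]]) auto
      moreover have "e m - q * (1 - e m) = - q + (1 + q) * inverse (real (Suc m))"
        by (simp add: e_def algebra_simps)
      ultimately show "Liminf at_top (\<lambda>t. ereal ((ln (L t) - q * ln t) / ln (ln t))) \<le> ereal (- q + (1 + q) * inverse (real (Suc m)))"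
        by (simp only:)
    qed
    \<comment> \<open>this common value vanishes exactly for \<open>d = 1\<close>, where the iterated logarithm is needed\<close>
    have crit: "1 / \<alpha> - q * (1 - 1 / \<alpha>) = - ((d - 1) / (\<alpha> - d))"
      using ad unfolding q_def by (simp add: field_simps)
    have Limsup_le: "Limsup at_top (\<lambda>t. ereal ((ln (L t) - q * ln t) / ln (ln t))) \<le> ereal (- ((d - 1) / (\<alpha> - d)))"
      unfolding crit[symmetric] using \<beta>
      by (intro Limsup_excess_le[OF time_lim ev_W1 scale_eventually_pos excess_lim time_cont L_pos up_growth[of 0, unfolded up_eq]]) auto
    have Limsup_ge: "ereal (- ((d - 1) / (\<alpha> - d))) \<le> Limsup at_top (\<lambda>t. ereal ((ln (L t) - q * ln t) / ln (ln t)))"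
      unfolding crit[symmetric] using d
      by (intro Limsup_excess_ge[OF time_lim ev_W1 scale_eventually_pos excess_lim rec_growth[unfolded rec_def]]) auto
    have Limsup_le_1: "Limsup at_top (\<lambda>t. ereal ((ln (L t) - q * ln t) / ln (ln (ln t)))) \<le> ereal (1 / (\<alpha> - d))" if "d = 1"
    proof (rule LIMSEQ_le_const[OF LIMSEQ_add_inverse[of "1 / (\<alpha> - d)" "1 / (\<alpha> - d)"]], intro exI allI impI)
      fix m
      have "1 / \<alpha> = q * (1 - 1 / \<alpha>)" using crit that by simp
      then have "Limsup at_top (\<lambda>t. ereal ((ln (L t) - q * ln t) / ln (ln (ln t)))) \<le> ereal ((1 + e m) / \<alpha> * (1 + q))"
        using \<beta>
        by (intro Limsup_excess_le[OF time_lim ev_W2 scale_eventually_pos excess_lim_crit time_cont L_pos up_growth[of m, unfolded up_eq]]) auto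
      moreover have "(1 + e m) / \<alpha> * (1 + q) = (1 + e m) / (\<alpha> - d)"
        unfolding q1 using ad by simp
      moreover have "(1 + e m) / (\<alpha> - d) = 1 / (\<alpha> - d) + 1 / (\<alpha> - d) * inverse (real (Suc m))"
        by (simp add: e_def add_divide_distrib)
      ultimately show "Limsup at_top (\<lambda>t. ereal ((ln (L t) - q * ln t) / ln (ln (ln t))))
          \<le> ereal (1 / (\<alpha> - d) + 1 / (\<alpha> - d) * inverse (real (Suc m)))" by simp
    qed
    have Limsup_ge_1: "ereal (1 / (\<alpha> - d)) \<le> Limsup at_top (\<lambda>t. ereal ((ln (L t) - q * ln t) / ln (ln (ln t))))" if "d = 1"
    proof -
      have "1 / \<alpha> = q * (1 - 1 / \<alpha>)" using crit that by simp
      then have "ereal (1 / \<alpha> * (1 + q)) \<le> Limsup at_top (\<lambda>t. ereal ((ln (L t) - q * ln t) / ln (ln (ln t))))"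
        using d
        by (intro Limsup_excess_ge[OF time_lim ev_W2 scale_eventually_pos excess_lim_crit rec_growth[unfolded rec_def]]) auto
      moreover have "1 / \<alpha> * (1 + q) = 1 / (\<alpha> - d)" unfolding q1 using ad by simp
      ultimately show ?thesis by simp
    qed
    show "let d = real CARD('d); L = pam_growth_rate (\<lambda>z. \<xi> z \<omega>) in
      (d > 1 \<longrightarrow>
         Limsup at_top (\<lambda>t. ereal ((ln (L t) - d / (\<alpha> - d) * ln t) / ln (ln t)))
           = ereal (- ((d - 1) / (\<alpha> - d)))) \<and>
      (d = 1 \<longrightarrow>
         Limsup at_top (\<lambda>t. ereal ((ln (L t) - d / (\<alpha> - d) * ln t) / ln (ln (ln t))))
           = ereal (1 / (\<alpha> - d))) \<and>
      Liminf at_top (\<lambda>t. ereal ((ln (L t) - d / (\<alpha> - d) * ln t) / ln (ln t)))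
        = ereal (- (d / (\<alpha> - d)))"
      unfolding Let_def d_def[symmetric] V_def[symmetric] L_def[symmetric] q_def[symmetric]
      using Liminf_ge Liminf_le Limsup_ge Limsup_le Limsup_ge_1 Limsup_le_1
      by (intro conjI impI antisym) auto
  qed
qed

end
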